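(* Let $n\ge 2$, $0\le l<k\le n$ and $\alpha>0$. Let $A=\mathrm{diag}(a_1,\dots,a_n)\in\mathcal{A}_{k,l}$, and write $H_k=H_k(\lambda(A))$, $h_l=h_l(\lambda(A))$ and $\mathcal{H}_{k,l}=\frac{k-l}{2(H_k-h_l)}$. Fix $\beta\in\mathbb{R}$ and $\bar s>0$, and let $$\omega_\alpha(x)=\omega_\alpha\left(\tfrac12x^TAx\right),\qquad \omega_\alpha(s)=\beta+\int_{\bar s}^{s}v_\alpha(t)\,dt\quad(s>0),$$ where $v_\alpha(s)>1$ is the solution of $$\left(v_\alpha(s)^{k-l}-1\right)v_\alpha(s)^{2\mathcal{H}_{k,l}h_l}=\alpha s^{-\mathcal{H}_{k,l}},\qquad s>0.$$ Then $\omega_\alpha$ is a smooth $k$-convex subsolution of $\frac{\sigma_k(\lambda(D^2u))}{\sigma_l(\lambda(D^2u))}=1$ in $\mathbb{R}^n\setminus\{0\}$. Furthermore, with the constants $\mu_1(\alpha),\dots,\mu_4(\alpha)$ given in the context: (i) Assume $n\ge 3$. If $k-l=1$ and $H_k-h_l<\frac12$, then $$\omega_\alpha(x)=\tfrac12x^TAx+\mu_1(\alpha)+O\left(|x|^{2-2\mathcal{H}_{k,l}}\right),\quad|x|\to\infty;$$ if $k-l\ge 2$, then $$\omega_\alpha(x)=\tfrac12x^TAx+\mu_1(\alpha)+O\left(|x|^{\theta(2-n)}\right),\quad|x|\to\infty,$$ for some $\theta\in\left(\frac{k-l-2}{n-2},1\right]$ (with $\theta=1$ in the case $l=0$, $k=n$).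 (ii) If $n=k=2$ and $l=0$, then $$\omega_\alpha(x)=\tfrac12x^TAx+\tfrac{\alpha}{2}\ln\left(\tfrac12x^TAx\right)+\mu_2(\alpha)+O(|x|^{-2}),\quad|x|\to\infty.$$ (iii) If $k-l=1$ and $H_k-h_l=\frac12$, then $$\omega_\alpha(x)=\tfrac12x^TAx+\alpha\ln\left(\tfrac12x^TAx\right)+\mu_3(\alpha)+O(|x|^{-2}),\quad|x|\to\infty.$$ (iv) If $k-l=1$ and $H_k-h_l>\frac12$, then, for some $\theta\in(-1,0)$, as $|x|\to\infty$, $$\omega_\alpha(x)=\tfrac12x^TAx+\frac{\alpha}{1-\frac{1}{2(H_k-h_l)}}\left(\tfrac12x^TAx\right)^{1-\frac{1}{2(H_k-h_l)}}+\mu_4(\alpha)+O(|x|^{2\theta}).$$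
   Context: For a real symmetric matrix $M$, $\lambda(M)=(\lambda_1,\dots,\lambda_n)$ denotes its eigenvalues. $\sigma_j(\lambda)=\sum_{1\le i_1<\cdots<i_j\le n}\lambda_{i_1}\cdots\lambda_{i_j}$ is the $j$-th elementary symmetric function, with $\sigma_0\equiv 1$. $\mathcal{A}_{k,l}$ is the set of real $n\times n$ symmetric positive definite matrices $A$ with $\sigma_k(\lambda(A))=\sigma_l(\lambda(A))$. For $A\in\mathcal{A}_{k,l}$ with eigenvalues $a=(a_1,\dots,a_n)$, let $\sigma_{j;i}(a)$ denote $\sigma_j(a)$ evaluated with $a_i$ replaced by $0$, and set $$H_k(\lambda(A))=\max_{1\le i\le n}\frac{\sigma_{k-1;i}(a)a_i}{\sigma_k(a)},\qquad h_l(\lambda(A))=\min_{1\le i\le n}\frac{\sigma_{l-1;i}(a)a_i}{\sigma_l(a)}\ (l\ge1),\qquad h_0\equiv 0.$$ Let $\Gamma_k=\{\lambda\in\mathbb{R}^n:\sigma_j(\lambda)>0,\ 1\le j\le k\}$. A $C^2$ function $u$ is $k$-convex if $\lambda(D^2u)\in\overline{\Gamma}_k$ everywhere in its domain. A smooth $k$-convex function $u$ is a subsolution of the equation if $\sigma_k(\lambda(D^2u))/\sigma_l(\lambda(D^2u))\ge 1$ everywhere in its domain. The constants, each used only in the case where it appears (in which the corresponding integral is finite), are $$\mu_1(\alpha)=\beta-\bar s+\int_{\bar s}^\infty\left(v_\alpha(t)-1\right)dt,$$ $$\mu_2(\alpha)=\beta-\bar s-\frac{\alpha}{2}\ln\bar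 s+\int_{\bar s}^\infty\left(v_\alpha(t)-1-\frac{\alpha}{2t}\right)dt,$$ $$\mu_3(\alpha)=\beta-\bar s-\alpha\ln\bar s+\int_{\bar s}^\infty\left(v_\alpha(t)-1-\frac{\alpha}{t}\right)dt,$$ $$\mu_4(\alpha)=\beta-\bar s-\frac{\alpha}{1-\frac{1}{2(H_k-h_l)}}\,\bar s^{\,1-\frac{1}{2(H_k-h_l)}}+\int_{\bar s}^\infty\left(v_\alpha(t)-1-\alpha t^{-\frac{1}{2(H_k-h_l)}}\right)dt.$$ *)

theory Defs
  imports "HOL-Analysis.Analysis" "HOL-Library.Landau_Symbols"
begin

section \<open>Eigenvalues and elementary symmetric functions\<close>

text \<open>
  The eigenvalues are the roots of the characteristic polynomial, counted with multiplicity. The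
  index type is unordered, so the choice operator fixes some enumeration of them; for a
  symmetric matrix they exist and are real, and every notion applied to the result below is
  invariant under permuting the entries.
\<close>

definition eigvals :: "real^'n^'n \<Rightarrow> real^'n" where
  "eigvals M = (SOME lam. \<forall>t. det (mat t - M) = (\<Prod>i\<in>UNIV. t - lam $ i))"

definition elem_sym :: "nat \<Rightarrow> real^'n \<Rightarrow> real" where
  "elem_sym j lam = (\<Sum>I | card I = j. \<Prod>i\<in>I. lam $ i)"

definition elem_sym_del :: "nat \<Rightarrow> 'n \<Rightarrow> real^'n \<Rightarrow> real" where
  "elem_sym_del j i lam = elem_sym j (\<chi> m. if m = i then 0 else lam $ m)"

definition H_max :: "nat \<Rightarrow> real^'n \<Rightarrow> real" where
  "H_max k a = (MAX i\<in>UNIV. elem_sym_del (k - 1) i a * a $ i / elem_sym k a)"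

definition h_min :: "nat \<Rightarrow> real^'n \<Rightarrow> real" where
  "h_min l a = (if l = 0 then 0 else (MIN i\<in>UNIV. elem_sym_del (l - 1) i a * a $ i / elem_sym l a))"

definition diag :: "real^'n \<Rightarrow> real^'n^'n" where
  "diag a = (\<chi> i j. if i = j then a $ i else 0)"

definition pos_def :: "real^'n^'n \<Rightarrow> bool" where
  "pos_def M \<longleftrightarrow> (\<forall>x. x \<noteq> 0 \<longrightarrow> x \<bullet> (M *v x) > 0)"

definition admissible :: "nat \<Rightarrow> nat \<Rightarrow> (real^'n^'n) set" where
  "admissible k l = {M. transpose M = M \<and> pos_def M \<and> elem_sym k (eigvals M) = elem_sym l (eigvals M)}"


section \<open>Smooth \<open>k\<close>-convex subsolutions\<close>

definition partial_deriv :: "'n \<Rightarrow> (real^'n \<Rightarrow> real) \<Rightarrow> real^'n \<Rightarrow> real" where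
  "partial_deriv i f x = frechet_derivative f (at x) (axis i 1)"

text \<open>Meant for open \<open>S\<close>, where \<open>differentiable_on\<close> is differentiability at each point.\<close>

primrec Ck_on :: "nat \<Rightarrow> (real^'n) set \<Rightarrow> (real^'n \<Rightarrow> real) \<Rightarrow> bool" where
  "Ck_on 0 S f \<longleftrightarrow> continuous_on S f"
| "Ck_on (Suc m) S f \<longleftrightarrow> f differentiable_on S \<and> (\<forall>i. Ck_on m S (partial_deriv i f))"

definition smooth_on :: "(real^'n) set \<Rightarrow> (real^'n \<Rightarrow> real) \<Rightarrow> bool" where
  "smooth_on S f \<longleftrightarrow> (\<forall>m. Ck_on m S f)"

definition hessian :: "(real^'n \<Rightarrow> real) \<Rightarrow> real^'n \<Rightarrow> real^'n^'n" where
  "hessian u x = (\<chi> i j. partial_deriv i (partial_deriv j u) x)"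

definition Gamma_cone :: "nat \<Rightarrow> (real^'n) set" where
  "Gamma_cone k = {lam. \<forall>j\<in>{1..k}. elem_sym j lam > 0}"

definition k_convex_on :: "nat \<Rightarrow> (real^'n) set \<Rightarrow> (real^'n \<Rightarrow> real) \<Rightarrow> bool" where
  "k_convex_on k S u \<longleftrightarrow> Ck_on 2 S u \<and> (\<forall>x\<in>S. eigvals (hessian u x) \<in> closure (Gamma_cone k))"

definition smooth_subsolution_on ::
    "nat \<Rightarrow> nat \<Rightarrow> (real^'n) set \<Rightarrow> (real^'n \<Rightarrow> real) \<Rightarrow> bool" where
  "smooth_subsolution_on k l S u \<longleftrightarrow>
     smooth_on S u \<and> k_convex_on k S u \<and>
     (\<forall>x\<in>S. elem_sym k (eigvals (hessian u x)) / elem_sym l (eigvals (hessian u x)) \<ge> 1)"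


section \<open>The radial profile and the constants\<close>

definition v_sol :: "nat \<Rightarrow> nat \<Rightarrow> real \<Rightarrow> real \<Rightarrow> real \<Rightarrow> real \<Rightarrow> real" where
  "v_sol k l \<H> hl \<alpha> s =
     (THE v. v > 1 \<and> (v ^ (k - l) - 1) * v powr (2 * \<H> * hl) = \<alpha> * s powr (- \<H>))"

text \<open>
  For positive definite \<open>A\<close> one has \<open>hl \<ge> 0\<close> and \<open>Hk > hl\<close>, so the sign condition below is met.
\<close>

lemma v_sol_ex1:
  fixes \<H> hl \<alpha> s :: real
  assumes "l < k" "\<H> * hl \<ge> 0" "\<alpha> > 0" "s > 0"
  shows "\<exists>!v. v > 1 \<and> (v ^ (k - l) - 1) * v powr (2 * \<H> * hl) = \<alpha> * s powr (- \<H>)"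
proof -
  define f where "f = (\<lambda>v::real. (v ^ (k - l) - 1) * v powr (2 * \<H> * hl))"
  define c where "c = \<alpha> * s powr (- \<H>)"
  have c: "c > 0" using assms by (simp add: c_def)
  have mono: "f x < f y" if "1 \<le> x" "x < y" for x y
  proof -
    have "x ^ (k - l) < y ^ (k - l)" using that assms by (intro power_strict_mono) auto
    moreover have "x powr (2 * \<H> * hl) \<le> y powr (2 * \<H> * hl)"
      using that assms by (intro powr_mono2) (auto simp: mult.assoc)
    moreover have "0 \<le> x ^ (k - l) - 1" using that by (simp add: one_le_power)
    ultimately show ?thesis unfolding f_def using that
      by (intro mult_less_le_imp_less) auto
  qed
  have ge: "c \<le> f (1 + c)"
  proof -
    have "1 + c \<le> (1 + c) ^ (k - l)" using assms c by (intro self_le_power) auto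
    moreover have "1 \<le> (1 + c) powr (2 * \<H> * hl)"
      using c assms by (intro ge_one_powr_ge_zero) (auto simp: mult.assoc)
    ultimately have "c * 1 \<le> f (1 + c)" unfolding f_def using c by (intro mult_mono) auto
    then show ?thesis by simp
  qed
  have "continuous_on {1..1 + c} f" unfolding f_def by (intro continuous_intros) auto
  with ge c obtain v where v: "1 \<le> v" "f v = c"
    using IVT'[of f 1 c "1 + c"] by (force simp: f_def)
  with c have "v \<noteq> 1" by (auto simp: f_def)
  with v have "v > 1 \<and> f v = c" by auto
  moreover have "w = v" if "w > 1 \<and> f w = c" for w
    using mono[of v w] mono[of w v] that v by (metis less_imp_le less_irrefl linorder_neqE)
  ultimately show ?thesis unfolding f_def c_def by blast
qed

text \<open>The integral is oriented, so this also covers \<open>s < sbar\<close>.\<close>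

definition omega :: "(real \<Rightarrow> real) \<Rightarrow> real \<Rightarrow> real \<Rightarrow> real \<Rightarrow> real" where
  "omega v \<beta> sbar s = \<beta> + (LBINT t=sbar..s. v t)"

text \<open>
  The integrals below are Lebesgue integrals, with value 0 when the integrand is not integrable;
  integrability therefore has to be asserted separately wherever one of these constants is used.
\<close>

definition mu1 :: "(real \<Rightarrow> real) \<Rightarrow> real \<Rightarrow> real \<Rightarrow> real" where
  "mu1 v \<beta> sbar = \<beta> - sbar + (LBINT t=sbar..\<infinity>. v t - 1)"

definition mu2 :: "(real \<Rightarrow> real) \<Rightarrow> real \<Rightarrow> real \<Rightarrow> real \<Rightarrow> real" where
  "mu2 v \<alpha> \<beta> sbar =
     \<beta> - sbar - \<alpha> / 2 * ln sbar + (LBINT t=sbar..\<infinity>. v t - 1 - \<alpha> / (2 * t))"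

definition mu3 :: "(real \<Rightarrow> real) \<Rightarrow> real \<Rightarrow> real \<Rightarrow> real \<Rightarrow> real" where
  "mu3 v \<alpha> \<beta> sbar =
     \<beta> - sbar - \<alpha> * ln sbar + (LBINT t=sbar..\<infinity>. v t - 1 - \<alpha> / t)"

definition mu4 :: "(real \<Rightarrow> real) \<Rightarrow> real \<Rightarrow> real \<Rightarrow> real \<Rightarrow> real \<Rightarrow> real \<Rightarrow> real" where
  "mu4 v Hk hl \<alpha> \<beta> sbar =
     \<beta> - sbar - \<alpha> / (1 - 1 / (2 * (Hk - hl))) * sbar powr (1 - 1 / (2 * (Hk - hl)))
     + (LBINT t=sbar..\<infinity>. v t - 1 - \<alpha> * t powr (- (1 / (2 * (Hk - hl)))))"

end

theory Submission
  imports Defs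
    "HOL-Computational_Algebra.Fundamental_Theorem_Algebra"
    "HOL-Real_Asymp.Real_Asymp"
begin

text \<open>
  At a point with \<open>s = x\<^sup>T A x / 2\<close>, the Hessian of the radial function is the diagonal matrix \<open>v A\<close>
  plus the rank-one matrix \<open>v' (A x) (A x)\<^sup>T\<close>, so that
  \<open>\<sigma>\<^sub>j = v\<^sup>j\<^sup>-\<^sup>1 \<sigma>\<^sub>j(a) (v + v' \<Sum> r\<^sub>i a\<^sub>i x\<^sub>i\<^sup>2)\<close> with \<open>r\<^sub>i = \<sigma>\<^sub>j\<^sub>-\<^sub>1\<^sub>;\<^sub>i(a) a\<^sub>i / \<sigma>\<^sub>j(a)\<close>. By log-concavity of
  the elementary symmetric functions \<open>r\<^sub>i\<close> increases with \<open>j\<close>, hence is at most \<open>H\<^sub>k\<close> for \<open>j \<le> k\<close>.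
  Since \<open>v' < 0\<close>, all these \<open>\<sigma>\<^sub>j\<close> are bounded below through \<open>v + 2 s H\<^sub>k v'\<close>, and \<open>\<sigma>\<^sub>l\<close> is bounded above
  through \<open>v + 2 s h\<^sub>l v'\<close>. Differentiating the implicit equation of \<open>v\<close> shows that the former is
  positive and that the latter is \<open>v\<^sup>k\<^sup>-\<^sup>l\<close> times the former, which is exactly what the subsolution
  property needs. The expansions follow by integrating \<open>v = 1 + \<alpha> s\<^sup>-\<^sup>H / (k - l) + O(s\<^sup>-\<^sup>2\<^sup>H)\<close>.
\<close>


section \<open>Elementary symmetric functions of positive numbers\<close>

text \<open>The generating polynomial of the elementary symmetric functions of the family
  \<open>f\<close> over \<open>S\<close>. Deleting an index deletes a linear factor, so identities
  and inequalities can be proved by adding one factor at a time.\<close>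

definition esym_poly :: "'a set \<Rightarrow> ('a \<Rightarrow> real) \<Rightarrow> real poly" where
  "esym_poly S f = (\<Prod>i\<in>S. [:1, f i:])"

lemma coeff_linear_mult:
  "coeff ([:1, x:] * p) j = coeff p j + (if j = 0 then 0 else x * coeff p (j - 1))"
  for x :: "'a::comm_ring_1"
  by (cases j) auto

lemma esym_poly_insert:
  assumes "finite S" "i \<notin> S"
  shows "esym_poly (insert i S) f = [:1, f i:] * esym_poly S f"
  using assms by (simp add: esym_poly_def)

lemma coeff_esym_poly: "coeff (esym_poly UNIV (($) x)) j = elem_sym j x"
  for x :: "real^'n"
proof -
  have P: "(\<Prod>i\<in>X. [:0, x $ i:]) = monom (\<Prod>i\<in>X. x $ i) (card X)" for X :: "'n set"
  proof (induction X rule: infinite_finite_induct)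
    case (insert i X)
    have "[:0, x $ i:] = monom (x $ i) 1" by (simp add: monom_altdef)
    with insert show ?case by (simp add: mult_monom)
  qed auto
  have "esym_poly UNIV (($) x) = (\<Prod>i\<in>UNIV. [:0, x $ i:] + 1)"
    unfolding esym_poly_def by (intro prod.cong) (auto simp: one_pCons)
  also have "\<dots> = (\<Sum>X\<in>Pow UNIV. monom (\<Prod>i\<in>X. x $ i) (card X))"
    by (subst prod_add) (auto simp: P)
  finally have "coeff (esym_poly UNIV (($) x)) j
      = (\<Sum>X\<in>Pow UNIV. if card X = j then \<Prod>i\<in>X. x $ i else 0)"
    by (simp add: coeff_sum coeff_monom)
  also have "\<dots> = elem_sym j x"
    unfolding elem_sym_def by (simp add: sum.If_cases)
  finally show ?thesis .
qed

text \<open>An entry replaced by 0 contributes the factor 1, which is the same as omitting it from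
  the product.\<close>

lemma elem_sym_del_eq_coeff: "elem_sym_del j i x = coeff (esym_poly (UNIV - {i}) (($) x)) j"
  for x :: "real^'n"
proof -
  have "esym_poly UNIV (($) (\<chi> m. if m = i then 0 else x $ m)) = 
      [:1, 0:] * esym_poly (UNIV - {i}) (($) (\<chi> m. if m = i then 0 else x $ m))"
    using esym_poly_insert[of "UNIV - {i}" i "($) (\<chi> m. if m = i then 0 else x $ m)"]
    by (simp add: insert_absorb)
  also have "esym_poly (UNIV - {i}) (($) (\<chi> m. if m = i then 0 else x $ m))
      = esym_poly (UNIV - {i}) (($) x)"
    unfolding esym_poly_def by (intro prod.cong) auto
  also have "[:1, 0:] = (1 :: real poly)" by (simp add: one_pCons)
  finally show ?thesis
    by (simp only: elem_sym_del_def coeff_esym_poly[symmetric] mult_1_left)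
qed

lemma esym_poly_UNIV_remove:
  "esym_poly UNIV (($) x) = [:1, x $ i:] * esym_poly (UNIV - {i}) (($) x)"
  for x :: "real^'n"
  using esym_poly_insert[of "UNIV - {i}" i "($) x"] by (simp add: insert_absorb)

lemma elem_sym_Suc:
  "elem_sym (Suc j) x = elem_sym_del (Suc j) i x + x $ i * elem_sym_del j i x"
  for x :: "real^'n"
  unfolding elem_sym_del_eq_coeff coeff_esym_poly[symmetric] esym_poly_UNIV_remove[of x i]
  by simp

lemma elem_sym_0 [simp]: "elem_sym 0 x = 1" for x :: "real^'n"
proof -
  have "{I :: 'n set. card I = 0} = {{}}" by auto
  then show ?thesis by (simp add: elem_sym_def)
qed

text \<open>Compare coefficients in the derivative of the generating polynomial; this is Euler's
  identity for the homogeneous function sigma_(j+1).\<close>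

lemma sum_elem_sym_del:
  "(\<Sum>i\<in>UNIV. x $ i * elem_sym_del j i x) = real (Suc j) * elem_sym (Suc j) x"
  for x :: "real^'n"
proof -
  have "real (Suc j) * elem_sym (Suc j) x = coeff (pderiv (esym_poly UNIV (($) x))) j"
    by (simp add: coeff_pderiv coeff_esym_poly)
  also have "\<dots> = (\<Sum>i\<in>UNIV. x $ i * elem_sym_del j i x)"
    unfolding elem_sym_del_eq_coeff by (simp add: esym_poly_def pderiv_prod coeff_sum pderiv_pCons mult.commute)
  finally show ?thesis ..
qed

lemma elem_sym_scaleR: "elem_sym j (c *\<^sub>R x) = c ^ j * elem_sym j x" for x :: "real^'n"
  unfolding elem_sym_def sum_distrib_left by (intro sum.cong) (auto simp: prod.distrib)

lemma elem_sym_del_scaleR: "elem_sym_del j i (c *\<^sub>R x) = c ^ j * elem_sym_del j i x"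
  for x :: "real^'n"
proof -
  have "(\<chi> m. if m = i then 0 else (c *\<^sub>R x) $ m) = c *\<^sub>R (\<chi> m. if m = i then 0 else x $ m)"
    by (simp add: vec_eq_iff)
  then show ?thesis by (simp only: elem_sym_del_def elem_sym_scaleR)
qed

section \<open>Positivity and log-concavity\<close>

text \<open>Both halves go through one induction: vanishing above the degree makes all coefficients
  nonnegative, and at the new top degree positivity comes only from the shifted term of the
  recursion.\<close>

lemma coeff_esym_poly_pos:
  assumes "finite S" "\<And>i. i \<in> S \<Longrightarrow> f i > 0"
  shows "(j \<le> card S \<longrightarrow> coeff (esym_poly S f) j > 0) \<and> (j > card S \<longrightarrow> coeff (esym_poly S f) j = 0)"
  using assms
proof (induction S arbitrary: j rule: finite_induct)
  case (insert i S)
  have IH: "\<And>j. j \<le> card S \<Longrightarrow> coeff (esym_poly S f) j > 0"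
    "\<And>j. j > card S \<Longrightarrow> coeff (esym_poly S f) j = 0" and fi: "f i > 0"
    using insert by auto
  have nn: "coeff (esym_poly S f) j \<ge> 0" for j
    using IH[of j] by (cases "j \<le> card S") (auto simp: less_imp_le)
  show ?case
    unfolding esym_poly_insert[OF insert(1,2)] coeff_linear_mult
    using insert(1,2) fi IH(1)[of j] IH(1)[of "j - 1"] IH(2)[of j] IH(2)[of "j - 1"] nn[of j]
    by (auto intro!: add_pos_nonneg add_nonneg_pos mult_pos_pos)
qed (auto simp: esym_poly_def)

text \<open>
  In this form log-concavity is inherited by multiplication with a linear factor.
\<close>

lemma coeff_esym_poly_log_concave:
  assumes "finite S" "\<And>i. i \<in> S \<Longrightarrow> f i > 0" "j \<le> k"
  shows "coeff (esym_poly S f) j * coeff (esym_poly S f) (Suc k)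
    \<le> coeff (esym_poly S f) (Suc j) * coeff (esym_poly S f) k"
  using assms
proof (induction S arbitrary: j k rule: finite_induct)
  case (insert i S)
  define e where "e = coeff (esym_poly S f)"
  define x where "x = f i"
  have x: "x > 0" using insert by (auto simp: x_def)
  have IH: "e j * e (Suc k) \<le> e (Suc j) * e k" if "j \<le> k" for j k
    using insert that by (auto simp: e_def)
  have nn: "e j \<ge> 0" for j
    using coeff_esym_poly_pos[OF insert(1), of f j] insert(4)
    by (cases "j \<le> card S") (auto simp: e_def less_imp_le)
  have c: "coeff (esym_poly (insert i S) f) j = e j + (if j = 0 then 0 else x * e (j - 1))" for j
    unfolding esym_poly_insert[OF insert(1,2)] coeff_linear_mult e_def x_def ..
  show ?case
  proof (cases k)
    case 0
    with insert(5) show ?thesis by simp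
  next
    case (Suc k')
    show ?thesis
    proof (cases j)
      case 0
      have "e 0 * e (Suc k) \<le> e (Suc 0) * e k" using IH by simp
      moreover have "0 \<le> x * (x * (e 0 * e k'))" "0 \<le> x * (e 1 * e k')"
        using x nn by (auto intro!: mult_nonneg_nonneg)
      ultimately show ?thesis unfolding c 0 Suc by (simp add: algebra_simps)
    next
      case (Suc j')
      note k = \<open>k = Suc k'\<close>
      have 1: "e j * e (Suc k) \<le> e (Suc j) * e k" using IH insert(5) by simp
      have 3: "e j' * e k \<le> e j * e k'" using IH[of j' k'] insert(5) k Suc by simp
      \<comment> \<open>The mixed term is two index steps apart and is reached by chaining through
        \<open>e j * e k\<close>. The chain needs \<open>j \<le> k'\<close>; for
        \<open>j = k\<close> the two sides are equal.\<close>
      have 2: "e j' * e (Suc k) \<le> e (Suc j) * e k'"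
      proof (cases "j = k")
        case False
        have "e j' * e (Suc k) \<le> e j * e k" using IH[of j' k] insert(5) Suc by simp
        also have "e j * e k \<le> e (Suc j) * e k'" using IH[of j k'] insert(5) False k by simp
        finally show ?thesis .
      qed (use k Suc in simp)
      have "e j * e (Suc k) + x * (e j' * e (Suc k)) + x * (x * (e j' * e k))
        \<le> e (Suc j) * e k + x * (e (Suc j) * e k') + x * (x * (e j * e k'))"
        by (intro add_mono mult_left_mono 1 2 3) (use x in auto)
      then show ?thesis unfolding c k Suc by (simp add: algebra_simps)
    qed
  qed
qed (auto simp: esym_poly_def)

lemma elem_sym_pos:
  fixes x :: "real^'n"
  assumes "\<And>i. x $ i > 0" "j \<le> CARD('n)"
  shows "elem_sym j x > 0"
  using coeff_esym_poly_pos[of UNIV "($) x" j] assms by (simp add: coeff_esym_poly)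

lemma elem_sym_del_pos:
  fixes x :: "real^'n"
  assumes "\<And>i. x $ i > 0" "j < CARD('n)"
  shows "elem_sym_del j i x > 0"
  using coeff_esym_poly_pos[of "UNIV - {i}" "($) x" j] assms by (simp add: elem_sym_del_eq_coeff)

lemma elem_sym_del_eq_0:
  fixes x :: "real^'n"
  assumes "\<And>i. x $ i > 0" "j \<ge> CARD('n)"
  shows "elem_sym_del j i x = 0"
proof -
  have "CARD('n) > 0" by (rule zero_less_card_finite)
  with assms(2) have "card (UNIV - {i}) < j" by (simp only: card_Diff_singleton UNIV_I)
  with coeff_esym_poly_pos[of "UNIV - {i}" "($) x" j] assms show ?thesis
    by (simp add: elem_sym_del_eq_coeff)
qed

section \<open>The ratios behind H_k and h_l\<close>

text \<open>For \<open>j \<ge> 1\<close> this is the logarithmic derivative of sigma_j with respect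
  to ln x_i. \<open>H_max\<close> is its maximum and \<open>h_min\<close> its minimum over
  \<open>i\<close>.\<close>

definition esym_ratio :: "nat \<Rightarrow> 'n \<Rightarrow> real^'n \<Rightarrow> real" where
  "esym_ratio j i x = elem_sym_del (j - 1) i x * x $ i / elem_sym j x"

text \<open>Splitting off x_i in both denominators and cross-multiplying, the products containing
  x_i twice cancel, and what remains is log-concavity of the functions with x_i deleted. It lets H_k
  control the ratios of all orders up to k.\<close>

lemma esym_ratio_mono:
  fixes x :: "real^'n"
  assumes x: "\<And>i. x $ i > 0" and "1 \<le> j" "j \<le> k" "k \<le> CARD('n)"
  shows "esym_ratio j i x \<le> esym_ratio k i x"
proof -
  obtain j' k' where jk: "j = Suc j'" "k = Suc k'" "j' \<le> k'"
    using assms by (metis Suc_le_D Suc_le_mono One_nat_def le_trans)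
  define e where "e m = elem_sym_del m i x" for m
  have "e j' * e (Suc k') \<le> e (Suc j') * e k'"
    unfolding e_def elem_sym_del_eq_coeff
    by (intro coeff_esym_poly_log_concave) (use x jk in auto)
  then have "x $ i * (e j' * e (Suc k')) \<le> x $ i * (e (Suc j') * e k')"
    using x[of i] by simp
  moreover have "0 < elem_sym j x" "0 < elem_sym k x" using elem_sym_pos[of x] assms by auto
  ultimately show ?thesis
    unfolding esym_ratio_def jk elem_sym_Suc[of _ x i] e_def[symmetric]
    by (simp add: divide_simps) (simp add: algebra_simps)
qed

lemma esym_ratio_pos:
  fixes x :: "real^'n"
  assumes "\<And>i. x $ i > 0" "1 \<le> j" "j \<le> CARD('n)"
  shows "esym_ratio j i x > 0"
  unfolding esym_ratio_def using assms
  by (intro divide_pos_pos mult_pos_pos elem_sym_pos elem_sym_del_pos) auto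

text \<open>The numerator is sigma_j minus its version with x_i deleted, and the latter is zero
  exactly at top order. The equality case later singles out k = n.\<close>

lemma esym_ratio_le_1:
  fixes x :: "real^'n"
  assumes x: "\<And>i. x $ i > 0" and j: "1 \<le> j" "j \<le> CARD('n)"
  shows "esym_ratio j i x \<le> 1" "esym_ratio j i x = 1 \<longleftrightarrow> j = CARD('n)"
proof -
  obtain j' where j': "j = Suc j'" using j by (cases j) auto
  have pos: "elem_sym j x > 0" using x j elem_sym_pos by auto
  have e: "elem_sym_del (j - 1) i x * x $ i = elem_sym j x - elem_sym_del j i x"
    using elem_sym_Suc[of j' x i] j' by simp
  have d: "elem_sym_del j i x \<ge> 0" "elem_sym_del j i x = 0 \<longleftrightarrow> j = CARD('n)"
    using elem_sym_del_pos[of x j i] elem_sym_del_eq_0[of x j i] x j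
    by (cases "j < CARD('n)"; force)+
  show "esym_ratio j i x \<le> 1" "esym_ratio j i x = 1 \<longleftrightarrow> j = CARD('n)"
    unfolding esym_ratio_def e using pos d by (auto simp: divide_simps)
qed

lemma sum_esym_ratio:
  fixes x :: "real^'n"
  assumes x: "\<And>i. x $ i > 0" and j: "1 \<le> j" "j \<le> CARD('n)"
  shows "(\<Sum>i\<in>UNIV. esym_ratio j i x) = real j"
proof -
  obtain j' where j': "j = Suc j'" using j by (cases j) auto
  have "elem_sym j x > 0" using x j elem_sym_pos by auto
  then show ?thesis
    using sum_elem_sym_del[of x j'] unfolding esym_ratio_def sum_divide_distrib[symmetric]
    by (simp add: j' mult.commute)
qed

lemma H_max_eq: "H_max k x = (MAX i\<in>UNIV. esym_ratio k i x)"
  by (simp add: H_max_def esym_ratio_def)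

lemma h_min_eq: "h_min l x = (if l = 0 then 0 else (MIN i\<in>UNIV. esym_ratio l i x))"
  by (simp add: h_min_def esym_ratio_def)

lemma esym_ratio_le_H_max: "esym_ratio k i x \<le> H_max k x"
  unfolding H_max_eq by (intro Max_ge) auto

lemma h_min_le_esym_ratio: "l \<ge> 1 \<Longrightarrow> h_min l x \<le> esym_ratio l i x"
  unfolding h_min_eq by (auto intro: Min_le)

lemma H_max_attained: "\<exists>i. H_max k x = esym_ratio k i x"
proof -
  have "H_max k x \<in> range (\<lambda>i. esym_ratio k i x)" unfolding H_max_eq by (intro Max_in) auto
  then show ?thesis by auto
qed

lemma h_min_attained: "l \<ge> 1 \<Longrightarrow> \<exists>i. h_min l x = esym_ratio l i x"
proof -
  assume "l \<ge> 1"
  then have "h_min l x = (MIN i\<in>UNIV. esym_ratio l i x)" by (simp add: h_min_eq)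
  also have "\<dots> \<in> range (\<lambda>i. esym_ratio l i x)" by (intro Min_in) auto
  finally show ?thesis by auto
qed

text \<open>The maximum is at least the average, and the ratios sum to k. The bound for
  \<open>h_min\<close> is the same with minimum and l.\<close>

lemma H_max_ge:
  fixes x :: "real^'n"
  assumes "\<And>i. x $ i > 0" "1 \<le> k" "k \<le> CARD('n)"
  shows "real k / CARD('n) \<le> H_max k x"
proof -
  have "real k = (\<Sum>i\<in>UNIV. esym_ratio k i x)" using sum_esym_ratio assms by metis
  also have "\<dots> \<le> real CARD('n) * H_max k x"
    using sum_bounded_above[of UNIV "\<lambda>i. esym_ratio k i x" "H_max k x"]
    by (simp add: esym_ratio_le_H_max)
  finally show ?thesis by (simp add: divide_simps mult.commute)
qed

lemma h_min_le:
  fixes x :: "real^'n"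
  assumes "\<And>i. x $ i > 0" "l \<le> CARD('n)"
  shows "h_min l x \<le> real l / CARD('n)"
proof (cases "l = 0")
  case False
  then have "real l = (\<Sum>i\<in>UNIV. esym_ratio l i x)" using sum_esym_ratio[of x l] assms by simp
  also have "\<dots> \<ge> real CARD('n) * h_min l x"
    using sum_bounded_below[of UNIV "h_min l x" "\<lambda>i. esym_ratio l i x"] False
    by (simp add: h_min_le_esym_ratio)
  finally show ?thesis by (simp add: divide_simps mult.commute)
qed (simp add: h_min_eq)

lemma H_max_le_1:
  fixes x :: "real^'n"
  assumes "\<And>i. x $ i > 0" "1 \<le> k" "k \<le> CARD('n)"
  shows "H_max k x \<le> 1" "H_max k x = 1 \<longleftrightarrow> k = CARD('n)"
  using esym_ratio_le_1[of x k] H_max_attained[of k x] assms by force+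

lemma h_min_nonneg:
  fixes x :: "real^'n"
  assumes "\<And>i. x $ i > 0" "l \<le> CARD('n)"
  shows "h_min l x \<ge> 0" "h_min l x = 0 \<longleftrightarrow> l = 0"
proof -
  have "l = 0 \<and> h_min l x = 0 \<or> l \<noteq> 0 \<and> h_min l x > 0"
    using esym_ratio_pos[of x l] h_min_attained[of l x] assms
    by (cases "l = 0") (force simp: h_min_eq)+
  then show "h_min l x \<ge> 0" "h_min l x = 0 \<longleftrightarrow> l = 0" by auto
qed

section \<open>Independence of the enumeration of the entries\<close>

text \<open>Equal generating polynomials express that two vectors agree up to order. The common
  linear factor can be cancelled, since its constant term 1 makes it nonzero.\<close>

lemma esym_ratio_transfer:
  fixes x y :: "real^'n"
  assumes "esym_poly UNIV (($) x) = esym_poly UNIV (($) y)" "x $ i = y $ m"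
  shows "esym_ratio j i x = esym_ratio j m y"
proof -
  have "[:1, x $ i:] * esym_poly (UNIV - {i}) (($) x) = [:1, x $ i:] * esym_poly (UNIV - {m}) (($) y)"
    using assms esym_poly_UNIV_remove[of x i] esym_poly_UNIV_remove[of y m] by simp
  then have "esym_poly (UNIV - {i}) (($) x) = esym_poly (UNIV - {m}) (($) y)"
    by (subst (asm) mult_cancel_left) auto
  then show ?thesis
    using assms unfolding esym_ratio_def elem_sym_del_eq_coeff coeff_esym_poly[symmetric] by simp
qed

text \<open>A nonzero entry x_i is visible as the root -1/x_i of the generating polynomial.\<close>

lemma esym_poly_eq_entry:
  fixes x y :: "real^'n"
  assumes "esym_poly UNIV (($) x) = esym_poly UNIV (($) y)" "x $ i \<noteq> 0"
  shows "\<exists>m. x $ i = y $ m"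
proof -
  have "poly (esym_poly UNIV (($) x)) (- 1 / x $ i) = 0"
    using assms(2) by (auto simp: esym_poly_def poly_prod)
  with assms obtain m where "1 + (- 1 / x $ i) * y $ m = 0"
    by (auto simp: esym_poly_def poly_prod)
  with assms(2) show ?thesis by (intro exI[of _ m]) (simp add: field_simps)
qed

lemma range_esym_ratio_cong:
  fixes x y :: "real^'n"
  assumes "esym_poly UNIV (($) x) = esym_poly UNIV (($) y)" "\<And>i. x $ i \<noteq> 0" "\<And>i. y $ i \<noteq> 0"
  shows "range (\<lambda>i. esym_ratio j i x) = range (\<lambda>i. esym_ratio j i y)"
  using esym_poly_eq_entry[OF assms(1)] esym_poly_eq_entry[OF assms(1)[symmetric]]
    esym_ratio_transfer[OF assms(1)] esym_ratio_transfer[OF assms(1)[symmetric]] assms(2,3)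
  by (auto simp: image_iff) metis+

lemma H_max_cong:
  fixes x y :: "real^'n"
  assumes "esym_poly UNIV (($) x) = esym_poly UNIV (($) y)" "\<And>i. x $ i \<noteq> 0" "\<And>i. y $ i \<noteq> 0"
  shows "H_max j x = H_max j y" "h_min j x = h_min j y"
  unfolding H_max_eq h_min_eq range_esym_ratio_cong[OF assms] by auto


section \<open>Rank-one perturbations of diagonal matrices\<close>

text \<open>A permutation fixing every index other than \<open>k\<close> also fixes
  \<open>k\<close>. Any other permutation therefore picks an off-diagonal zero from one of the axis
  rows, and only the identity contributes.\<close>

lemma det_single_full_row:
  fixes b :: "'n::finite \<Rightarrow> 'a::comm_ring_1" and u :: "'a^'n"
  shows "det (\<chi> i. if i = k then u else axis i (b i)) = u $ k * (\<Prod>i\<in>UNIV - {k}. b i)"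
proof -
  define B where "B = (\<chi> i. if i = k then u else axis i (b i))"
  have z: "of_int (sign p) * (\<Prod>i\<in>UNIV. B $ i $ p i) = 0" if p: "p permutes UNIV" "p \<noteq> id" for p
  proof -
    have "\<exists>i. i \<noteq> k \<and> p i \<noteq> i"
    proof (rule ccontr)
      assume "\<not> ?thesis"
      then have fp: "p i = i" if "i \<noteq> k" for i using that by blast
      moreover have "p k = k" using fp permutes_inj[OF p(1)] by (metis injD)
      ultimately have "p = id" by fastforce
      with p show False by simp
    qed
    then obtain i where "i \<noteq> k" "p i \<noteq> i" by blast
    then have "B $ i $ p i = 0" by (simp add: B_def axis_def)
    then have "(\<Prod>i\<in>UNIV. B $ i $ p i) = 0" by (subst prod.remove[of _ i]) auto
    then show ?thesis by simp
  qed
  have "det B = (\<Sum>p\<in>{id}. of_int (sign p) * (\<Prod>i\<in>UNIV. B $ i $ p i))"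
    unfolding det_def by (rule sum.mono_neutral_right) (use z permutes_id in auto)
  also have "\<dots> = (\<Prod>i\<in>UNIV. B $ i $ i)" by (simp add: sign_id)
  also have "\<dots> = u $ k * (\<Prod>i\<in>UNIV - {k}. B $ i $ i)" by (subst prod.remove[of _ k]) (auto simp: B_def)
  also have "(\<Prod>i\<in>UNIV - {k}. B $ i $ i) = (\<Prod>i\<in>UNIV - {k}. b i)"
    by (intro prod.cong) (auto simp: B_def)
  finally show ?thesis unfolding B_def .
qed

text \<open>
  By multilinearity in the rows, since a determinant with two rows proportional to \<open>u\<close> vanishes.
\<close>

lemma det_rank_one_rows:
  fixes b c :: "'n::finite \<Rightarrow> 'a::comm_ring_1" and u :: "'a^'n"
  assumes "finite S" "k \<notin> S"
  shows "det (\<chi> i. if i = k then u else if i \<in> S then axis i (b i) + c i *s u else axis i (b i))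
    = u $ k * (\<Prod>i\<in>UNIV - {k}. b i)"
  using assms
proof (induction S rule: finite_induct)
  case empty
  then show ?case by (simp only: empty_iff if_False if_cancel det_single_full_row)
next
  case (insert m S)
  define r where "r i = (if i = k then u else if i \<in> S then axis i (b i) + c i *s u else axis i (b i))" for i
  have "det (\<chi> i. if i = k then u else if i \<in> insert m S then axis i (b i) + c i *s u else axis i (b i))
    = det (\<chi> i. if i = m then axis i (b i) + c i *s u else r i)"
    using insert by (intro arg_cong[of _ _ det]) (auto simp: vec_eq_iff r_def)
  also have "\<dots> = det (\<chi> i. if i = m then axis i (b i) else r i) + det (\<chi> i. if i = m then c i *s u else r i)"
    by (rule det_row_add)
  also have "(\<chi> i. if i = m then c i *s u else r i) = (\<chi> i. if i = m then c m *s u else r i)"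
    by (simp add: vec_eq_iff)
  also have "det \<dots> = c m * det (\<chi> i. if i = m then u else r i)"
    by (rule det_row_mul[where a = "\<lambda>_. u"])
  also have "det (\<chi> i. if i = m then u else r i) = 0"
    by (rule det_identical_rows[of m k]) (use insert in \<open>auto simp: row_def r_def vec_eq_iff\<close>)
  also have "(\<chi> i. if i = m then axis i (b i) else r i) = (\<chi> i. r i)"
    using insert by (auto simp: vec_eq_iff r_def)
  also have "det (\<chi> i. r i) = u $ k * (\<Prod>i\<in>UNIV - {k}. b i)"
    using insert unfolding r_def by simp
  finally show ?case by simp
qed

text \<open>The rows are perturbed one after another. Splitting row \<open>m\<close> by linearity
  leaves either its diagonal part or \<open>c m\<close> times \<open>u\<close>; in the second case
  \<open>det_rank_one_rows\<close> discards the perturbations of the other rows.\<close>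

lemma det_diag_plus_rank_one_rows:
  fixes b c :: "'n::finite \<Rightarrow> 'a::comm_ring_1" and u :: "'a^'n"
  assumes "finite S"
  shows "det (\<chi> i. if i \<in> S then axis i (b i) + c i *s u else axis i (b i))
    = (\<Prod>i\<in>UNIV. b i) + (\<Sum>k\<in>S. c k * u $ k * (\<Prod>i\<in>UNIV - {k}. b i))"
  using assms
proof (induction S rule: finite_induct)
  case empty
  show ?case by (simp add: det_diagonal axis_def)
next
  case (insert m S)
  define r where "r i = (if i \<in> S then axis i (b i) + c i *s u else axis i (b i))" for i
  have "det (\<chi> i. if i \<in> insert m S then axis i (b i) + c i *s u else axis i (b i))
    = det (\<chi> i. if i = m then axis i (b i) + c i *s u else r i)"
    using insert by (intro arg_cong[of _ _ det]) (auto simp: vec_eq_iff r_def)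
  also have "\<dots> = det (\<chi> i. if i = m then axis i (b i) else r i) + det (\<chi> i. if i = m then c i *s u else r i)"
    by (rule det_row_add)
  also have "(\<chi> i. if i = m then c i *s u else r i) = (\<chi> i. if i = m then c m *s u else r i)"
    by (simp add: vec_eq_iff)
  also have "det \<dots> = c m * det (\<chi> i. if i = m then u else r i)"
    by (rule det_row_mul[where a = "\<lambda>_. u"])
  also have "det (\<chi> i. if i = m then u else r i) = u $ m * (\<Prod>i\<in>UNIV - {m}. b i)"
    unfolding r_def using insert by (intro det_rank_one_rows) auto
  also have "(\<chi> i. if i = m then axis i (b i) else r i) = (\<chi> i. r i)"
    using insert by (auto simp: vec_eq_iff r_def)
  finally show ?case
    using insert unfolding r_def by (simp add: algebra_simps)
qed

text \<open>The matrix determinant lemma in a form without divisions, so the diagonal entries may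
  vanish.\<close>

lemma det_diag_plus_rank_one:
  fixes b c :: "'n::finite \<Rightarrow> 'a::comm_ring_1" and u :: "'a^'n"
  shows "det (\<chi> i j. (if i = j then b i else 0) + c i * u $ j)
    = (\<Prod>i\<in>UNIV. b i) + (\<Sum>k\<in>UNIV. c k * u $ k * (\<Prod>i\<in>UNIV - {k}. b i))"
proof -
  have "(\<chi> i j. (if i = j then b i else 0) + c i * u $ j)
    = (\<chi> i. if i \<in> UNIV then axis i (b i) + c i *s u else axis i (b i))"
    by (auto simp: vec_eq_iff axis_def)
  then show ?thesis using det_diag_plus_rank_one_rows[of UNIV b c u] by simp
qed


section \<open>Eigenvalues of symmetric matrices\<close>

text \<open>The determinant is taken over the ring of polynomials, so that degree arguments and the
  fundamental theorem of algebra apply to it.\<close>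

definition char_poly :: "'a::comm_ring_1^'n^'n \<Rightarrow> 'a poly" where
  "char_poly M = det (\<chi> i j. (if i = j then [:0, 1:] else 0) - [:M $ i $ j:])"

lemma poly_char_poly: "poly (char_poly M) t = det (mat t - M)"
  unfolding char_poly_def det_def
  by (auto simp: poly_sum poly_prod mat_def intro!: sum.cong arg_cong2[of _ _ _ _ "(*)"] prod.cong)

text \<open>Each permutation contributes degree at most its number of fixed points. Only the
  identity reaches \<open>CARD('n)\<close>, and its product is monic.\<close>

lemma degree_char_poly:
  fixes M :: "'a::idom^'n^'n"
  shows "degree (char_poly M) = CARD('n) \<and> lead_coeff (char_poly M) = 1"
proof -
  define B where "B i j = (if i = j then [:0, 1:] else 0) - [:M $ i $ j:]" for i j
  define T where "T p = of_int (sign p) * (\<Prod>i\<in>UNIV. B i (p i))" for p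
  have Bdeg: "degree (B i j) \<le> (if i = j then 1 else 0)" for i j
    by (auto simp: B_def)
  have le: "degree (\<Prod>i\<in>UNIV. B i (p i)) \<le> card {i. p i = i}" for p
  proof -
    have "degree (\<Prod>i\<in>UNIV. B i (p i)) \<le> (\<Sum>i\<in>UNIV. degree (B i (p i)))"
      using degree_prod_sum_le[of UNIV "\<lambda>i. B i (p i)"] by (simp add: o_def)
    also have "\<dots> \<le> (\<Sum>i\<in>UNIV. if p i = i then 1 else 0)"
      using Bdeg by (intro sum_mono) (metis)
    also have "\<dots> = card {i. p i = i}" by (simp add: sum.If_cases)
    finally show ?thesis .
  qed
  have Tdeg: "degree (T p) \<le> degree (\<Prod>i\<in>UNIV. B i (p i))" for p
    unfolding T_def by (auto simp: sign_def)
  have cP: "char_poly M = (\<Sum>p\<in>{p. p permutes UNIV}. T p)"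
    by (simp add: char_poly_def det_def T_def B_def)
  have "degree (char_poly M) \<le> CARD('n)"
    unfolding cP
  proof (rule degree_sum_le)
    fix p :: "'n \<Rightarrow> 'n"
    have "card {i. p i = i} \<le> CARD('n)" by (intro card_mono) auto
    then show "degree (T p) \<le> CARD('n)" using Tdeg[of p] le[of p] by linarith
  qed (simp add: finite_permutations)
  moreover have "coeff (char_poly M) CARD('n) = 1"
  proof -
    have 0: "coeff (T p) CARD('n) = 0" if "p \<noteq> id" for p
    proof -
      have "{i. p i = i} \<subset> UNIV" using that by fastforce
      then have "card {i. p i = i} < CARD('n)" by (intro psubset_card_mono) auto
      then show ?thesis using Tdeg[of p] le[of p] by (intro coeff_eq_0) linarith
    qed
    have "coeff (char_poly M) CARD('n) = (\<Sum>p\<in>{p. p permutes UNIV}. coeff (T p) CARD('n))"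
      by (simp add: cP coeff_sum)
    also have "\<dots> = (\<Sum>p\<in>{id}. coeff (T p) CARD('n))"
      by (rule sum.mono_neutral_right) (use 0 permutes_id in \<open>auto simp: finite_permutations\<close>)
    also have "\<dots> = coeff (\<Prod>i\<in>UNIV. B i i) CARD('n)" by (simp add: T_def sign_id)
    also have "\<dots> = 1"
    proof -
      have Bi: "B i i = [:- M $ i $ i, 1:]" for i by (simp add: B_def)
      have "degree (\<Prod>i\<in>UNIV. B i i) = CARD('n)"
        by (subst degree_prod_eq_sum_degree) (auto simp: Bi)
      moreover have "lead_coeff (\<Prod>i\<in>UNIV. B i i) = 1"
        by (subst lead_coeff_prod) (simp add: Bi)
      ultimately show ?thesis by simp
    qed
    finally show ?thesis .
  qed
  ultimately show ?thesis
    by (metis le_antisym le_degree zero_neq_one)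
qed

text \<open>Serves to index the multiset of roots by the index type of the matrix.\<close>

lemma prod_mset_reindex:
  assumes "finite S" "size A = card S"
  shows "\<exists>f. (\<Prod>x\<in>#A. g x) = (\<Prod>i\<in>S. g (f i))"
  using assms
proof (induction S arbitrary: A rule: finite_induct)
  case (insert i S)
  then obtain x B where A: "A = add_mset x B" "size B = card S"
    by (metis card_insert_disjoint size_eq_Suc_imp_eq_union size_add_mset nat.inject)
  obtain f where "(\<Prod>x\<in>#B. g x) = (\<Prod>i\<in>S. g (f i))" using insert.IH A by blast
  moreover have "(\<Prod>m\<in>S. g ((f(i := x)) m)) = (\<Prod>i\<in>S. g (f i))"
    using insert.hyps by (intro prod.cong) auto
  ultimately show ?case using insert.hyps A by (intro exI[of _ "f(i := x)"]) simp
qed auto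

lemma char_poly_splits:
  fixes M :: "complex^'n^'n"
  shows "\<exists>z :: 'n \<Rightarrow> complex. char_poly M = (\<Prod>i\<in>UNIV. [:- z i, 1:])"
proof -
  have "char_poly M \<noteq> 0" using degree_char_poly[of M] by auto
  then obtain A where A: "size A = CARD('n)" "char_poly M = (\<Prod>x\<in>#A. [:- x, 1:])"
    using alg_closed_imp_factorization[of "char_poly M"] degree_char_poly[of M] by auto
  obtain z where "(\<Prod>x\<in>#A. [:- x, 1:]) = (\<Prod>i\<in>(UNIV :: 'n set). [:- z i, 1:])"
    using prod_mset_reindex[of "UNIV :: 'n set" A "\<lambda>x. [:- x, 1:]"] A by auto
  with A show ?thesis by auto
qed

text \<open>Pairing the eigenvector \<open>w\<close> with its conjugate gives \<open>z\<close> times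
  the squared norm \<open>N\<close> as the Hermitian form \<open>Q\<close>, and symmetry of
  \<open>M\<close> makes \<open>Q\<close> equal to its conjugate.\<close>

lemma symmetric_eigenvalue_real:
  fixes M :: "real^'n^'n" and z :: complex
  assumes sym: "transpose M = M" and z: "det (mat z - (\<chi> i j. of_real (M $ i $ j))) = 0"
  shows "z \<in> \<real>"
proof -
  define Mc :: "complex^'n^'n" where "Mc = (\<chi> i j. of_real (M $ i $ j))"
  have symM: "M $ i $ j = M $ j $ i" for i j
    using sym by (simp add: vec_eq_iff transpose_def)
  have "\<not> invertible (mat z - Mc)" using z by (simp add: invertible_det_nz Mc_def)
  then obtain w where w: "w \<noteq> 0" "(mat z - Mc) *v w = 0"
    by (metis invertible_left_inverse matrix_left_invertible_ker)
  have eig: "z * w $ i = (\<Sum>j\<in>UNIV. of_real (M $ i $ j) * w $ j)" for i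
  proof -
    have "((mat z - Mc) *v w) $ i = 0" using w by simp
    then have "(\<Sum>j\<in>UNIV. (if i = j then z else 0) * w $ j - of_real (M $ i $ j) * w $ j) = 0"
      by (simp add: matrix_vector_mult_def mat_def Mc_def algebra_simps)
    moreover have "(\<Sum>j\<in>UNIV. (if i = j then z else 0) * w $ j) = z * w $ i"
      by (subst sum.remove[of _ i]) auto
    ultimately show ?thesis by (simp add: sum_subtractf)
  qed
  define N where "N = (\<Sum>i\<in>UNIV. (cmod (w $ i))\<^sup>2)"
  define Q where "Q = (\<Sum>i\<in>UNIV. \<Sum>j\<in>UNIV. cnj (w $ i) * (of_real (M $ i $ j) * w $ j))"
  have "z * of_real N = (\<Sum>i\<in>UNIV. cnj (w $ i) * (z * w $ i))"
    unfolding N_def of_real_sum sum_distrib_left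
    by (intro sum.cong refl) (simp only: complex_norm_square mult_ac)
  also have "\<dots> = Q" unfolding eig Q_def sum_distrib_left ..
  finally have zN: "z * of_real N = Q" .
  have "cnj Q = (\<Sum>i\<in>UNIV. \<Sum>j\<in>UNIV. w $ i * (of_real (M $ i $ j) * cnj (w $ j)))"
    unfolding Q_def by simp
  also have "\<dots> = (\<Sum>j\<in>UNIV. \<Sum>i\<in>UNIV. w $ i * (of_real (M $ i $ j) * cnj (w $ j)))"
    by (rule sum.swap)
  also have "\<dots> = Q"
    unfolding Q_def by (intro sum.cong) (auto simp: symM mult_ac)
  finally have "cnj z * of_real N = z * of_real N" using zN by (metis complex_cnj_complex_of_real complex_cnj_mult)
  moreover have "N \<noteq> 0"
  proof -
    obtain i where "w $ i \<noteq> 0" using w(1) by (auto simp: vec_eq_iff)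
    then have "0 < N" unfolding N_def by (intro sum_pos2[of _ i]) auto
    then show ?thesis by simp
  qed
  ultimately show ?thesis by (simp add: Reals_cnj_iff)
qed

lemma det_of_real:
  fixes M :: "real^'n^'n"
  shows "det (\<chi> i j. of_real (M $ i $ j)) = (of_real (det M) :: complex)"
  unfolding det_def by simp

text \<open>The choice in \<open>eigvals\<close> has a candidate: the characteristic polynomial
  splits over the complex numbers, and symmetry makes its roots real.\<close>

lemma eigvals_symmetric:
  fixes M :: "real^'n^'n"
  assumes "transpose M = M"
  shows "det (mat t - M) = (\<Prod>i\<in>UNIV. t - eigvals M $ i)"
proof -
  define Mc :: "complex^'n^'n" where "Mc = (\<chi> i j. of_real (M $ i $ j))"
  obtain z :: "'n \<Rightarrow> complex" where z: "char_poly Mc = (\<Prod>i\<in>UNIV. [:- z i, 1:])"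
    using char_poly_splits by blast
  have "z i \<in> \<real>" for i
  proof -
    have "poly (char_poly Mc) (z i) = 0" unfolding z poly_prod by auto
    then show ?thesis
      using symmetric_eigenvalue_real[OF assms, of "z i"] by (simp add: poly_char_poly Mc_def)
  qed
  then obtain lam where lam: "z = (\<lambda>i. of_real (lam i))"
    by (intro that[of "\<lambda>i. Re (z i)"]) auto
  have "\<forall>t. det (mat t - M) = (\<Prod>i\<in>UNIV. t - (\<chi> i. lam i) $ i)"
  proof
    fix t
    have "of_real (det (mat t - M)) = det (mat (of_real t) - Mc)"
      unfolding det_of_real[symmetric] by (intro arg_cong[of _ _ det]) (auto simp: vec_eq_iff mat_def Mc_def)
    also have "\<dots> = poly (char_poly Mc) (of_real t)" by (simp add: poly_char_poly)
    also have "\<dots> = of_real (\<Prod>i\<in>UNIV. t - lam i)" unfolding z lam by (simp add: poly_prod)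
    finally show "det (mat t - M) = (\<Prod>i\<in>UNIV. t - (\<chi> i. lam i) $ i)" by (simp only: of_real_eq_iff vec_lambda_beta)
  qed
  then have "\<forall>t. det (mat t - M) = (\<Prod>i\<in>UNIV. t - eigvals M $ i)"
    unfolding eigvals_def by (rule someI)
  then show ?thesis by blast
qed

section \<open>Elementary symmetric functions of eigenvalues\<close>

text \<open>The determinant is the generating polynomial of the eigenvalues evaluated at
  \<open>t\<close>, and polynomials agreeing at all positive \<open>t\<close> coincide. The
  elementary symmetric functions of the spectrum are thus read off a determinant, whatever
  enumeration \<open>eigvals\<close> chose.\<close>

lemma esym_poly_eigvals:
  fixes M :: "real^'n^'n"
  assumes "transpose M = M" "\<And>t. t > 0 \<Longrightarrow> det (mat 1 + t *\<^sub>R M) = poly p t"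
  shows "esym_poly UNIV (($) (eigvals M)) = p"
proof -
  have eq: "poly (esym_poly UNIV (($) (eigvals M))) t = poly p t" if t: "t > 0" for t
  proof -
    have "poly p t = det (mat 1 + t *\<^sub>R M)" using assms t by simp
    \<comment> \<open>The reciprocal substitution: the matrix is \<open>- t\<close> times the
      characteristic matrix at \<open>- 1 / t\<close>, written row by row to pull the scalar out of
      the determinant.\<close>
    also have "mat 1 + t *\<^sub>R M = (\<chi> i. (- t) *s (mat (- 1 / t) - M) $ i)"
      using t by (auto simp: vec_eq_iff mat_def algebra_simps)
    also have "det \<dots> = (- t) ^ CARD('n) * det (mat (- 1 / t) - M)"
      by (subst det_rows_mul) simp
    also have "\<dots> = (\<Prod>i\<in>UNIV. (- t) * (- 1 / t - eigvals M $ i))"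
      unfolding eigvals_symmetric[OF assms(1)] by (simp only: prod.distrib prod_constant)
    also have "\<dots> = (\<Prod>i\<in>UNIV. 1 + t * eigvals M $ i)"
      using t by (intro prod.cong) (auto simp: algebra_simps)
    finally show ?thesis by (simp add: esym_poly_def poly_prod)
  qed
  have "infinite {0::real<..}" by (rule infinite_Ioi)
  moreover have "{0<..} \<subseteq> {t. poly (esym_poly UNIV (($) (eigvals M)) - p) t = 0}"
    using eq by auto
  ultimately have "infinite {t. poly (esym_poly UNIV (($) (eigvals M)) - p) t = 0}"
    using finite_subset by blast
  then have "esym_poly UNIV (($) (eigvals M)) - p = 0" using poly_roots_finite by blast
  then show ?thesis by simp
qed

text \<open>The matrix determinant lemma makes the determinant an explicit polynomial
  \<open>p\<close> in \<open>t\<close>, and coefficients are compared. The factor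
  \<open>[:0, c:]\<close> shifts degrees by one, whence the index \<open>j - 1\<close>.\<close>

lemma elem_sym_eigvals_diag_plus_rank_one:
  fixes d w :: "real^'n"
  assumes "j \<ge> 1"
  shows "elem_sym j (eigvals (\<chi> i m. (if i = m then d $ i else 0) + c * w $ i * w $ m))
    = elem_sym j d + c * (\<Sum>i\<in>UNIV. (w $ i)\<^sup>2 * elem_sym_del (j - 1) i d)"
proof -
  define M where "M = (\<chi> i m. (if i = m then d $ i else 0) + c * w $ i * w $ m)"
  define p where "p = esym_poly UNIV (($) d) +
    [:0, c:] * (\<Sum>i\<in>UNIV. [:(w $ i)\<^sup>2:] * esym_poly (UNIV - {i}) (($) d))"
  have "esym_poly UNIV (($) (eigvals M)) = p"
  proof (rule esym_poly_eigvals)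
    show "transpose M = M" by (auto simp: M_def transpose_def vec_eq_iff)
    fix t :: real
    have "mat 1 + t *\<^sub>R M = (\<chi> i m. (if i = m then 1 + t * d $ i else 0) + (t * c * w $ i) * w $ m)"
      by (auto simp: M_def mat_def vec_eq_iff algebra_simps)
    then have "det (mat 1 + t *\<^sub>R M) = (\<Prod>i\<in>UNIV. 1 + t * d $ i)
        + (\<Sum>k\<in>UNIV. (t * c * w $ k) * w $ k * (\<Prod>i\<in>UNIV - {k}. 1 + t * d $ i))"
      by (simp only: det_diag_plus_rank_one)
    moreover have "(\<Sum>k\<in>UNIV. (t * c * w $ k) * w $ k * (\<Prod>i\<in>UNIV - {k}. 1 + t * d $ i))
        = t * (c * (\<Sum>k\<in>UNIV. (w $ k)\<^sup>2 * (\<Prod>i\<in>UNIV - {k}. 1 + t * d $ i)))"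
      unfolding sum_distrib_left by (simp only: power2_eq_square mult.assoc)
    moreover have "poly p t = (\<Prod>i\<in>UNIV. 1 + t * d $ i)
        + t * (c * (\<Sum>k\<in>UNIV. (w $ k)\<^sup>2 * (\<Prod>i\<in>UNIV - {k}. 1 + t * d $ i)))"
      by (simp add: p_def esym_poly_def poly_prod poly_sum)
    ultimately show "det (mat 1 + t *\<^sub>R M) = poly p t" by simp
  qed
  moreover obtain j' where "j = Suc j'" using assms by (cases j) auto
  ultimately show ?thesis
    unfolding M_def[symmetric] coeff_esym_poly[symmetric] elem_sym_del_eq_coeff p_def
    by (simp add: coeff_sum)
qed

lemma esym_poly_eigvals_diag: "esym_poly UNIV (($) (eigvals (diag a))) = esym_poly UNIV (($) a)"
proof (rule esym_poly_eigvals)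
  show "transpose (diag a) = diag a" by (auto simp: diag_def transpose_def vec_eq_iff)
  fix t :: real
  have "det (mat 1 + t *\<^sub>R diag a) = (\<Prod>i\<in>UNIV. (mat 1 + t *\<^sub>R diag a) $ i $ i)"
    by (rule det_diagonal) (auto simp: mat_def diag_def)
  then show "det (mat 1 + t *\<^sub>R diag a) = poly (esym_poly UNIV (($) a)) t"
    by (simp add: mat_def diag_def esym_poly_def poly_prod)
qed

lemma elem_sym_eigvals_diag: "elem_sym j (eigvals (diag a)) = elem_sym j a"
  using esym_poly_eigvals_diag[of a] by (simp flip: coeff_esym_poly)

lemma H_max_eigvals_diag:
  fixes a :: "real^'n"
  assumes "\<And>i. a $ i > 0"
  shows "H_max j (eigvals (diag a)) = H_max j a" "h_min j (eigvals (diag a)) = h_min j a"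
proof -
  have eq: "esym_poly UNIV (($) (eigvals (diag a))) = esym_poly UNIV (($) a)"
    by (rule esym_poly_eigvals_diag)
  \<comment> \<open>The product of the eigenvalues equals that of the entries of \<open>a\<close>,
    which is positive. Hence no eigenvalue vanishes, as \<open>H_max_cong\<close> requires.\<close>
  have "elem_sym CARD('n) (eigvals (diag a)) = (\<Prod>i\<in>UNIV. eigvals (diag a) $ i)"
  proof -
    have "{I :: 'n set. card I = CARD('n)} = {UNIV}" 
      using card_eq_UNIV_imp_eq_UNIV[OF finite] by blast
    then show ?thesis by (simp add: elem_sym_def)
  qed
  moreover have "elem_sym CARD('n) (eigvals (diag a)) > 0"
    using elem_sym_pos[of a "CARD('n)"] assms by (simp add: elem_sym_eigvals_diag)
  ultimately have "eigvals (diag a) $ i \<noteq> 0" for i by (metis UNIV_I finite less_irrefl prod_zero_iff)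
  moreover have "a $ i \<noteq> 0" for i using assms[of i] by simp
  ultimately show "H_max j (eigvals (diag a)) = H_max j a" "h_min j (eigvals (diag a)) = h_min j a"
    using H_max_cong[OF eq] by auto
qed


section \<open>Smooth radial functions\<close>

lemma partial_deriv_eqI: "(f has_derivative f') (at x) \<Longrightarrow> partial_deriv i f x = f' (axis i 1)"
  unfolding partial_deriv_def using frechet_derivative_at by metis

lemma differentiable_has_partials:
  "f differentiable (at x) \<Longrightarrow> (f has_derivative frechet_derivative f (at x)) (at x)"
  by (simp add: frechet_derivative_works)

lemma has_derivative_cong_open:
  assumes "open S" "x \<in> S" "\<And>y. y \<in> S \<Longrightarrow> f y = g y"
  shows "(f has_derivative f') (at x) \<longleftrightarrow> (g has_derivative f') (at x)"
  using has_derivative_transform_within_open[OF _ assms(1,2), of f f' UNIV g]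
    has_derivative_transform_within_open[OF _ assms(1,2), of g f' UNIV f] assms(3) by auto

lemma partial_deriv_cong_open:
  assumes "open S" "x \<in> S" "\<And>y. y \<in> S \<Longrightarrow> f y = g y"
  shows "partial_deriv i f x = partial_deriv i g x"
proof -
  have "(f has_derivative f') (at x) \<longleftrightarrow> (g has_derivative f') (at x)" for f'
    using has_derivative_cong_open assms by metis
  then show ?thesis by (simp add: partial_deriv_def frechet_derivative_def)
qed

lemma differentiable_on_cong_open:
  assumes "open S" "\<And>y. y \<in> S \<Longrightarrow> f y = g y"
  shows "f differentiable_on S \<longleftrightarrow> g differentiable_on S"
  using has_derivative_cong_open[OF assms(1) _ assms(2)] assms(1)
  by (simp add: differentiable_on_eq_differentiable_at differentiable_def)

text \<open>Partial derivatives are matched with explicit expressions only on \<open>S\<close>;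
  openness makes differentiation local, so agreement there suffices at every order.\<close>

lemma Ck_on_cong:
  assumes "open S" "\<And>y. y \<in> S \<Longrightarrow> f y = g y"
  shows "Ck_on m S f \<longleftrightarrow> Ck_on m S g"
  using assms(2)
proof (induction m arbitrary: f g)
  case 0
  then show ?case using continuous_on_cong[OF refl, of S f g] by simp
next
  case (Suc m)
  have "Ck_on m S (partial_deriv i f) \<longleftrightarrow> Ck_on m S (partial_deriv i g)" for i
    by (rule Suc.IH) (use Suc.prems partial_deriv_cong_open[OF assms(1)] in blast)
  with differentiable_on_cong_open[OF assms(1) Suc.prems] show ?case by simp
qed

section \<open>Algebras of functions closed under differentiation\<close>

text \<open>Avoids formulas for higher derivatives: once the derivatives of the generators lie in
  the algebra, so do those of all its members, and smoothness follows.\<close>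

inductive_set generated_algebra :: "('a \<Rightarrow> real) set \<Rightarrow> ('a \<Rightarrow> real) set" for G where
  generator: "g \<in> G \<Longrightarrow> g \<in> generated_algebra G"
| const: "(\<lambda>_. c) \<in> generated_algebra G"
| add: "f \<in> generated_algebra G \<Longrightarrow> g \<in> generated_algebra G \<Longrightarrow> (\<lambda>x. f x + g x) \<in> generated_algebra G"
| mult: "f \<in> generated_algebra G \<Longrightarrow> g \<in> generated_algebra G \<Longrightarrow> (\<lambda>x. f x * g x) \<in> generated_algebra G"

lemma generated_algebra_power:
  "f \<in> generated_algebra G \<Longrightarrow> (\<lambda>x. f x ^ m) \<in> generated_algebra G"
  by (induction m) (auto intro: generated_algebra.intros)

lemma generated_algebra_diff:
  assumes "f \<in> generated_algebra G" "g \<in> generated_algebra G"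
  shows "(\<lambda>x. f x - g x) \<in> generated_algebra G"
proof -
  have "(\<lambda>x. f x + (- 1) * g x) \<in> generated_algebra G"
    by (intro generated_algebra.intros assms)
  then show ?thesis by simp
qed

lemma generated_algebra_partials:
  fixes G :: "(real^'n \<Rightarrow> real) set"
  assumes G: "\<And>g x. g \<in> G \<Longrightarrow> x \<in> S \<Longrightarrow> g differentiable (at x)"
    "\<And>g i. g \<in> G \<Longrightarrow> \<exists>h\<in>generated_algebra G. \<forall>x\<in>S. partial_deriv i g x = h x"
    and f: "f \<in> generated_algebra G"
  shows "(\<forall>x\<in>S. f differentiable (at x)) \<and>
    (\<forall>i. \<exists>h\<in>generated_algebra G. \<forall>x\<in>S. partial_deriv i f x = h x)"
  using f
proof induction
  case (const c)
  have "partial_deriv i (\<lambda>_. c) x = 0" for i and x :: "real^'n"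
    by (rule partial_deriv_eqI) (rule has_derivative_const)
  then show ?case by (auto intro!: bexI[OF _ generated_algebra.const])
next
  case (add f g)
  have "\<exists>h\<in>generated_algebra G. \<forall>x\<in>S. partial_deriv i (\<lambda>x. f x + g x) x = h x" for i
  proof -
    obtain f' g' where f': "f' \<in> generated_algebra G" "\<forall>x\<in>S. partial_deriv i f x = f' x"
      and g': "g' \<in> generated_algebra G" "\<forall>x\<in>S. partial_deriv i g x = g' x"
      using add.IH by blast
    have "partial_deriv i (\<lambda>x. f x + g x) x = f' x + g' x" if "x \<in> S" for x
    proof -
      have "f differentiable (at x)" "g differentiable (at x)" using add.IH that by auto
      from this[THEN differentiable_has_partials] have
        "partial_deriv i (\<lambda>x. f x + g x) x = frechet_derivative f (at x) (axis i 1) + frechet_derivative g (at x) (axis i 1)"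
        by (intro partial_deriv_eqI has_derivative_add)
      then show ?thesis using f' g' that unfolding partial_deriv_def by simp
    qed
    then show ?thesis using generated_algebra.add[OF f'(1) g'(1)] by (auto intro!: bexI)
  qed
  with add.IH show ?case by auto
next
  case (mult f g)
  have "\<exists>h\<in>generated_algebra G. \<forall>x\<in>S. partial_deriv i (\<lambda>x. f x * g x) x = h x" for i
  proof -
    obtain f' g' where f': "f' \<in> generated_algebra G" "\<forall>x\<in>S. partial_deriv i f x = f' x"
      and g': "g' \<in> generated_algebra G" "\<forall>x\<in>S. partial_deriv i g x = g' x"
      using mult.IH by blast
    have "partial_deriv i (\<lambda>x. f x * g x) x = f x * g' x + f' x * g x" if "x \<in> S" for x
    proof -
      have "f differentiable (at x)" "g differentiable (at x)" using mult.IH that by auto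
      from this[THEN differentiable_has_partials] have
        "partial_deriv i (\<lambda>x. f x * g x) x
          = f x * frechet_derivative g (at x) (axis i 1) + frechet_derivative f (at x) (axis i 1) * g x"
        by (intro partial_deriv_eqI has_derivative_mult)
      then show ?thesis using f' g' that unfolding partial_deriv_def by simp
    qed
    moreover have "(\<lambda>x. f x * g' x + f' x * g x) \<in> generated_algebra G"
      by (intro generated_algebra.add generated_algebra.mult mult.hyps f' g')
    ultimately show ?thesis by (auto intro!: bexI)
  qed
  with mult.IH show ?case by auto
qed (use G in auto)

text \<open>Induction on the order: each partial derivative agrees on \<open>S\<close> with another
  member of the algebra, to which the induction hypothesis applies.\<close>

lemma generated_algebra_smooth_on:
  fixes G :: "(real^'n \<Rightarrow> real) set"
  assumes S: "open S" and G: "\<And>g x. g \<in> G \<Longrightarrow> x \<in> S \<Longrightarrow> g differentiable (at x)"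
    "\<And>g i. g \<in> G \<Longrightarrow> \<exists>h\<in>generated_algebra G. \<forall>x\<in>S. partial_deriv i g x = h x"
    and f: "f \<in> generated_algebra G"
  shows "smooth_on S f"
proof -
  have "Ck_on m S f" for m
    using f
  proof (induction m arbitrary: f)
    case 0
    have "\<forall>x\<in>S. f differentiable (at x)" using generated_algebra_partials[OF G 0] by blast
    then show ?case
      by (auto intro!: continuous_at_imp_continuous_on differentiable_imp_continuous_within)
  next
    case (Suc m)
    note f = generated_algebra_partials[OF G Suc.prems]
    have "Ck_on m S (partial_deriv i f)" for i
    proof -
      obtain h where "h \<in> generated_algebra G" "\<forall>x\<in>S. partial_deriv i f x = h x"
        using f by blast
      then show ?thesis using Ck_on_cong[OF S, of "partial_deriv i f" h m] Suc.IH by blast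
    qed
    with f S show ?case by (auto simp: differentiable_on_eq_differentiable_at)
  qed
  then show ?thesis by (simp add: smooth_on_def)
qed

section \<open>Functions of the quadratic form\<close>

definition half_quad :: "real^'n \<Rightarrow> real^'n \<Rightarrow> real" where
  "half_quad a x = 1 / 2 * (x \<bullet> (diag a *v x))"

lemma half_quad_eq: "half_quad a x = (\<Sum>i\<in>UNIV. a $ i * (x $ i)\<^sup>2) / 2"
proof -
  have "(diag a *v x) $ i = a $ i * x $ i" for i
    by (simp add: diag_def matrix_vector_mult_def if_distrib if_distribR sum.delta' cong: if_cong)
  then show ?thesis by (simp add: half_quad_def inner_vec_def power2_eq_square mult_ac)
qed

lemma half_quad_ge:
  fixes a :: "real^'n"
  assumes "\<And>i. m \<le> a $ i"
  shows "m / 2 * (norm x)\<^sup>2 \<le> half_quad a x"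
proof -
  have "m * (norm x)\<^sup>2 = (\<Sum>i\<in>UNIV. m * (x $ i)\<^sup>2)"
    by (simp add: power2_norm_eq_inner inner_vec_def sum_distrib_left flip: power2_eq_square)
  also have "\<dots> \<le> (\<Sum>i\<in>UNIV. a $ i * (x $ i)\<^sup>2)"
    using assms by (intro sum_mono mult_right_mono) auto
  finally show ?thesis by (simp add: half_quad_eq)
qed

lemma half_quad_lower_bound:
  fixes a :: "real^'n"
  assumes "\<And>i. a $ i > 0"
  obtains m where "m > 0" "\<And>x. m * (norm x)\<^sup>2 \<le> half_quad a x"
proof -
  define m where "m = Min (range (($) a))"
  have "m > 0" "\<And>i. m \<le> a $ i" using assms by (auto simp: m_def)
  then show ?thesis using that[of "m / 2"] half_quad_ge[of m a] by auto
qed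

lemma half_quad_pos:
  fixes a :: "real^'n"
  assumes "\<And>i. a $ i > 0" "x \<noteq> 0"
  shows "half_quad a x > 0"
proof -
  obtain m where "m > 0" "\<And>x. m * (norm x)\<^sup>2 \<le> half_quad a x"
    using half_quad_lower_bound[OF assms(1)] by blast
  moreover have "(norm x)\<^sup>2 > 0" using assms(2) by simp
  ultimately show ?thesis by (metis less_le_trans mult_pos_pos)
qed

lemma vec_nth_has_derivative: "((\<lambda>x. x $ i) has_derivative (\<lambda>h. h $ i)) (at x)"
  for x :: "real^'n"
  by (rule bounded_linear_imp_has_derivative[OF bounded_linear_vec_nth])

lemma half_quad_has_derivative:
  "(half_quad a has_derivative (\<lambda>h. \<Sum>i\<in>UNIV. a $ i * x $ i * h $ i)) (at x)"
proof -
  have "((\<lambda>x. (\<Sum>i\<in>UNIV. a $ i * (x $ i)\<^sup>2) / 2) has_derivative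
      (\<lambda>h. (\<Sum>i\<in>UNIV. a $ i * (2 * x $ i * h $ i)) / 2)) (at x)"
    by (auto intro!: derivative_eq_intros vec_nth_has_derivative simp: mult_ac)
  moreover have "(\<Sum>i\<in>UNIV. a $ i * (2 * x $ i * h $ i)) / 2 = (\<Sum>i\<in>UNIV. a $ i * x $ i * h $ i)" for h
    by (simp add: sum_divide_distrib mult_ac)
  ultimately show ?thesis by (simp add: half_quad_eq[abs_def])
qed

lemma radial_has_derivative:
  assumes "(\<phi> has_real_derivative D) (at (half_quad a x))"
  shows "((\<lambda>x. \<phi> (half_quad a x)) has_derivative (\<lambda>h. D * (\<Sum>i\<in>UNIV. a $ i * x $ i * h $ i))) (at x)"
  using has_derivative_compose[OF half_quad_has_derivative, of \<phi>] assms
  by (auto simp: has_field_derivative_def o_def)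

lemma sum_axis: "(\<Sum>j\<in>UNIV. f j * axis i (1 :: real) $ j) = f i"
  by (simp add: axis_def if_distrib sum.delta' cong: if_cong)

lemma partial_deriv_radial:
  assumes "(\<phi> has_real_derivative D) (at (half_quad a x))"
  shows "partial_deriv i (\<lambda>x. \<phi> (half_quad a x)) x = D * (a $ i * x $ i)"
  using partial_deriv_eqI[OF radial_has_derivative[OF assms], of i] by (simp add: sum_axis)

text \<open>Off the origin the gradient is \<open>\<psi>\<close> times A x, and differentiating once
  more adds a multiple of the rank-one matrix of A x. The form of the result is that of
  \<open>elem_sym_eigvals_diag_plus_rank_one\<close>.\<close>

lemma hessian_radial:
  fixes a :: "real^'n"
  assumes a: "\<And>i. a $ i > 0" and x: "x \<noteq> 0"
    and \<phi>: "\<And>s. s > 0 \<Longrightarrow> (\<phi> has_real_derivative \<psi> s) (at s)"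
    and \<psi>: "(\<psi> has_real_derivative D) (at (half_quad a x))"
  shows "hessian (\<lambda>x. \<phi> (half_quad a x)) x = (\<chi> i m. (if i = m then (\<psi> (half_quad a x) *\<^sub>R a) $ i else 0)
    + D * (\<chi> i. a $ i * x $ i) $ i * (\<chi> i. a $ i * x $ i) $ m)"
proof -
  have "partial_deriv i (partial_deriv j (\<lambda>x. \<phi> (half_quad a x))) x
    = (if i = j then \<psi> (half_quad a x) * a $ i else 0) + D * (a $ i * x $ i) * (a $ j * x $ j)" for i j
  proof -
    have "partial_deriv i (partial_deriv j (\<lambda>x. \<phi> (half_quad a x))) x
      = partial_deriv i (\<lambda>x. \<psi> (half_quad a x) * (a $ j * x $ j)) x"
      using x by (intro partial_deriv_cong_open[of "- {0}"])
        (auto intro!: partial_deriv_radial \<phi> half_quad_pos a)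
    also have "\<dots> = \<psi> (half_quad a x) * (a $ j * axis i 1 $ j)
      + D * (\<Sum>m\<in>UNIV. a $ m * x $ m * axis i 1 $ m) * (a $ j * x $ j)"
      by (rule partial_deriv_eqI) (auto intro!: derivative_eq_intros radial_has_derivative vec_nth_has_derivative \<psi>)
    finally show ?thesis by (auto simp: sum_axis) (auto simp: axis_def)
  qed
  then show ?thesis by (simp add: hessian_def vec_eq_iff)
qed

text \<open>A differentially closed family in one variable is composed with the quadratic form. The
  coordinates join the generators because the chain rule produces the factors
  \<open>a $ i * x $ i\<close>.\<close>

lemma smooth_on_radial:
  fixes a :: "real^'n" and \<Phi> :: "(real \<Rightarrow> real) set"
  assumes a: "\<And>i. a $ i > 0"
    and \<Phi>: "\<And>\<phi>. \<phi> \<in> \<Phi> \<Longrightarrow> \<exists>\<psi>\<in>generated_algebra \<Phi>. \<forall>s>0. (\<phi> has_real_derivative \<psi> s) (at s)"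
    and "\<phi> \<in> \<Phi>"
  shows "smooth_on (- {0}) (\<lambda>x. \<phi> (half_quad a x))"
proof -
  define G where "G = (\<lambda>\<phi> x. \<phi> (half_quad a x)) ` \<Phi> \<union> range (\<lambda>i x. x $ i)"
  have lift: "(\<lambda>x. \<psi> (half_quad a x)) \<in> generated_algebra G" if "\<psi> \<in> generated_algebra \<Phi>" for \<psi>
    using that by induction (auto intro: generated_algebra.intros simp: G_def)
  have coord: "(\<lambda>x. x $ i) \<in> generated_algebra G" for i
    by (rule generated_algebra.generator) (auto simp: G_def)
  show ?thesis
  proof (rule generated_algebra_smooth_on[where G = G])
    fix g and x :: "real^'n" assume g: "g \<in> G" "x \<in> - {0}"
    consider \<phi> where "\<phi> \<in> \<Phi>" "g = (\<lambda>x. \<phi> (half_quad a x))" | i where "g = (\<lambda>x. x $ i)"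
      using g by (auto simp: G_def)
    then show "g differentiable (at x)"
    proof cases
      case (1 \<phi>)
      obtain \<psi> where "\<forall>s>0. (\<phi> has_real_derivative \<psi> s) (at s)" using \<Phi> 1 by blast
      then have "(\<phi> has_real_derivative \<psi> (half_quad a x)) (at (half_quad a x))"
        using half_quad_pos[OF a] g by blast
      from radial_has_derivative[OF this] show ?thesis unfolding 1 differentiable_def by blast
    next
      case (2 i)
      show ?thesis unfolding 2 differentiable_def by (blast intro: vec_nth_has_derivative)
    qed
  next
    fix g i assume "g \<in> G"
    then consider \<phi> where "\<phi> \<in> \<Phi>" "g = (\<lambda>x. \<phi> (half_quad a x))" | i where "g = (\<lambda>x. x $ i)"
      by (auto simp: G_def)
    then show "\<exists>h\<in>generated_algebra G. \<forall>x\<in>- {0}. partial_deriv i g x = h x"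
    proof cases
      case (1 \<phi>)
      obtain \<psi> where \<psi>: "\<psi> \<in> generated_algebra \<Phi>" "\<forall>s>0. (\<phi> has_real_derivative \<psi> s) (at s)"
        using \<Phi> 1 by blast
      have "(\<lambda>x. \<psi> (half_quad a x) * (a $ i * x $ i)) \<in> generated_algebra G"
        by (intro generated_algebra.mult generated_algebra.const lift \<psi> coord)
      moreover have "partial_deriv i g x = \<psi> (half_quad a x) * (a $ i * x $ i)" if "x \<noteq> 0" for x
        unfolding 1 using half_quad_pos[OF a that] \<psi> by (intro partial_deriv_radial) auto
      ultimately show ?thesis by (intro bexI) auto
    next
      case (2 j)
      have "partial_deriv i g x = axis i 1 $ j" for x
        unfolding 2 by (rule partial_deriv_eqI) (rule vec_nth_has_derivative)
      then show ?thesis by (auto intro!: bexI[OF _ generated_algebra.const])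
    qed
  next
    show "(\<lambda>x. \<phi> (half_quad a x)) \<in> generated_algebra G"
      by (rule generated_algebra.generator) (use \<open>\<phi> \<in> \<Phi>\<close> in \<open>auto simp: G_def\<close>)
  qed (rule open_Compl, simp)
qed


section \<open>The radial profile\<close>

lemma omega_has_derivative:
  assumes "continuous_on {0<..} v" "sbar > 0" "s > 0"
  shows "(omega v \<beta> sbar has_real_derivative v s) (at s)"
proof -
  \<comment> \<open>A compact interval inside the positive axis with \<open>sbar\<close> and
    \<open>s\<close> in its interior, whichever of the two is larger.\<close>
  define a b where "a = min sbar s / 2" and "b = max sbar s + 1"
  have ab: "0 < a" "a < sbar" "a < s" "sbar < b" "s < b"
    using assms by (auto simp: a_def b_def)
  have "continuous_on {a..b} v"
    by (rule continuous_on_subset[OF assms(1)]) (use ab in auto)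
  then have "((\<lambda>u. LBINT t=sbar..u. v t) has_vector_derivative v s) (at s within {a..b})"
    using ab by (intro interval_integral_FTC2) auto
  then have "((\<lambda>u. LBINT t=sbar..u. v t) has_real_derivative v s) (at s)"
    using ab by (simp add: at_within_Icc_at has_real_derivative_iff_has_vector_derivative)
  then show ?thesis
    unfolding omega_def[abs_def] by (auto intro!: derivative_eq_intros)
qed

section \<open>The implicit equation and its solution\<close>

text \<open>The analysis of the profile depends on the matrix only through two numbers with these
  inequalities, so it is carried out for arbitrary reals.\<close>

locale radial_profile =
  fixes k l :: nat and Hk hl \<alpha> :: real
  assumes lk: "l < k" and hl: "0 \<le> hl" and Hk: "hl < Hk" and \<alpha>: "0 < \<alpha>"
begin

definition H :: real where "H = real (k - l) / (2 * (Hk - hl))"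

definition v :: "real \<Rightarrow> real" where "v = v_sol k l H hl \<alpha>"

lemma H_pos: "H > 0"
  using lk Hk by (simp add: H_def)

lemma H_hl_nonneg: "H * hl \<ge> 0"
  using H_pos hl by simp

lemma v_ex1:
  assumes "s > 0"
  shows "\<exists>!w. w > 1 \<and> (w ^ (k - l) - 1) * w powr (2 * H * hl) = \<alpha> * s powr (- H)"
  using v_sol_ex1[OF lk H_hl_nonneg \<alpha> assms] .

lemma v_gt_1: "s > 0 \<Longrightarrow> v s > 1"
  and v_eq: "s > 0 \<Longrightarrow> (v s ^ (k - l) - 1) * v s powr (2 * H * hl) = \<alpha> * s powr (- H)"
  using theI'[OF v_ex1, of s] by (simp_all add: v_def v_sol_def)

lemma v_unique:
  assumes "s > 0" "w > 1" "(w ^ (k - l) - 1) * w powr (2 * H * hl) = \<alpha> * s powr (- H)"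
  shows "v s = w"
  using the1_equality[OF v_ex1, of s w] assms by (simp add: v_def v_sol_def)

lemma power_gt_1: "(w :: real) > 1 \<Longrightarrow> w ^ (k - l) > 1"
  using lk by (intro one_less_power) auto

lemma v_power_gt_1: "s > 0 \<Longrightarrow> v s ^ (k - l) > 1"
  using power_gt_1 v_gt_1 by blast

text \<open>The equation of \<open>v\<close> is explicit in \<open>s\<close>; solving it by
  logarithms gives the inverse function of \<open>v\<close>.\<close>

definition v_inv :: "real \<Rightarrow> real" where
  "v_inv w = exp ((ln \<alpha> - ln (w ^ (k - l) - 1) - 2 * H * hl * ln w) / H)"

lemma v_v_inv:
  assumes "w > 1"
  shows "v (v_inv w) = w"
proof (rule v_unique)
  have "v_inv w powr (- H) = exp (ln (w ^ (k - l) - 1) + 2 * H * hl * ln w - ln \<alpha>)"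
    using H_pos by (simp add: v_inv_def powr_def)
  also have "\<dots> = (w ^ (k - l) - 1) * w powr (2 * H * hl) / \<alpha>"
    using assms power_gt_1[OF assms] \<alpha> by (simp add: exp_diff exp_add powr_def)
  finally show "(w ^ (k - l) - 1) * w powr (2 * H * hl) = \<alpha> * v_inv w powr (- H)"
    using \<alpha> by simp
qed (use assms in \<open>auto simp: v_inv_def\<close>)

lemma v_inv_v:
  assumes "s > 0"
  shows "v_inv (v s) = s"
proof -
  have "ln ((v s ^ (k - l) - 1) * v s powr (2 * H * hl)) = ln (\<alpha> * s powr (- H))"
    using v_eq[OF assms] by simp
  then have "ln (v s ^ (k - l) - 1) + 2 * H * hl * ln (v s) = ln \<alpha> - H * ln s"
    using v_gt_1[OF assms] v_power_gt_1[OF assms] \<alpha> assms by (simp add: ln_mult ln_powr)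
  then have "(ln \<alpha> - ln (v s ^ (k - l) - 1) - 2 * H * hl * ln (v s)) / H = ln s"
    using H_pos by (simp add: field_simps)
  then show ?thesis using assms by (simp add: v_inv_def)
qed

lemma v_inv_has_derivative:
  assumes "w > 1"
  shows "(v_inv has_real_derivative
    - v_inv w * (real (k - l) * w ^ (k - l - 1) / (w ^ (k - l) - 1) + 2 * H * hl / w) / H) (at w)"
proof -
  have "w ^ (k - l) \<noteq> 1" using power_gt_1[OF assms] by simp
  then show ?thesis
    unfolding v_inv_def[abs_def]
    using assms power_gt_1[OF assms] H_pos
    by (auto intro!: derivative_eq_intros simp: field_simps)
qed

lemma denom_pos: "w > 1 \<Longrightarrow> Hk * w ^ (k - l) - hl > 0"
proof -
  assume "w > 1"
  then have "hl * 1 \<le> hl * w ^ (k - l)" "hl * w ^ (k - l) < Hk * w ^ (k - l)"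
    using power_gt_1[of w] hl Hk by (intro mult_left_mono mult_strict_right_mono; simp)+
  then show ?thesis by linarith
qed

text \<open>The inverse function rule applied to \<open>v_inv\<close>; replacing k - l by
  \<open>2 * H * (Hk - hl)\<close> makes \<open>H\<close> cancel.\<close>

lemma v_has_derivative:
  assumes s: "s > 0"
  shows "(v has_real_derivative
    - v s * (v s ^ (k - l) - 1) / (2 * s * (Hk * v s ^ (k - l) - hl))) (at s)"
proof -
  define w where "w = v s"
  have w: "w > 1" using v_gt_1[OF s] by (simp add: w_def)
  have sw: "v_inv w = s" using v_inv_v[OF s] by (simp add: w_def)
  define D where "D = - s * (real (k - l) * w ^ (k - l - 1) / (w ^ (k - l) - 1) + 2 * H * hl / w) / H"
  have D: "(v_inv has_real_derivative D) (at w)"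
    unfolding D_def using v_inv_has_derivative[OF w] by (simp add: sw)
  have wd: "w ^ (k - l) = w * w ^ (k - l - 1)"
    using lk by (metis Suc_diff_1 power_Suc zero_less_diff)
  define P where "P = w ^ (k - l)"
  have P: "P > 1" using power_gt_1[OF w] by (simp add: P_def)
  have den: "Hk * P - hl > 0" using denom_pos[OF w] by (simp add: P_def)
  have "w ^ (k - l - 1) = P / w" using wd w by (simp add: P_def)
  then have "D = - s * (real (k - l) * (P / w) / (P - 1) + 2 * H * hl / w) / H"
    by (simp add: D_def P_def)
  also have "real (k - l) = 2 * H * (Hk - hl)"
    using Hk unfolding H_def by (auto simp: divide_simps)
  also have "- s * (2 * H * (Hk - hl) * (P / w) / (P - 1) + 2 * H * hl / w) / H
      = - 2 * s * (Hk * P - hl) / (w * (P - 1))"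
  proof -
    have "(2 * H * (Hk - hl) * (P / w) / (P - 1) + 2 * H * hl / w) / H
      = 2 * ((Hk - hl) * P + hl * (P - 1)) / (w * (P - 1))"
      using w P H_pos by (simp add: divide_simps) (simp add: algebra_simps)
    also have "(Hk - hl) * P + hl * (P - 1) = Hk * P - hl" by (simp add: algebra_simps)
    finally have "(2 * H * (Hk - hl) * (P / w) / (P - 1) + 2 * H * hl / w) / H
      = 2 * (Hk * P - hl) / (w * (P - 1))" .
    then have "- s * ((2 * H * (Hk - hl) * (P / w) / (P - 1) + 2 * H * hl / w) / H)
      = - s * (2 * (Hk * P - hl) / (w * (P - 1)))" by (rule arg_cong)
    then show ?thesis by (simp only: times_divide_eq_right mult_minus_left mult_minus_right mult.assoc mult.left_commute[of s])
  qed
  finally have Deq: "D = - 2 * s * (Hk * P - hl) / (w * (P - 1))" .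
  \<comment> \<open>The inverse function rule asks for continuity of \<open>v\<close>, which comes
    from that of \<open>v_inv\<close>; the radius keeps the neighbourhood of \<open>w\<close> above
    1.\<close>
  have "isCont v (v_inv w)"
  proof (rule isCont_inverse_function[where f = v_inv and x = w and d = "(w - 1) / 2"])
    show "0 < (w - 1) / 2" using w by simp
    fix z assume "\<bar>z - w\<bar> \<le> (w - 1) / 2"
    then have z: "z > 1" using w by (auto simp: abs_if split: if_splits)
    show "v (v_inv z) = z" using v_v_inv[OF z] .
    show "isCont v_inv z" using v_inv_has_derivative[OF z] by (rule DERIV_isCont)
  qed
  then have "(v has_real_derivative inverse D) (at s)"
    using D s w P den v_inv_v sw
    by (intro DERIV_inverse_function[where f = v_inv and a = 0 and b = "s + 1"]) (auto simp: Deq w_def)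
  also have "inverse D = - w * (P - 1) / (2 * s * (Hk * P - hl))"
    using s w P den by (simp add: Deq divide_simps)
  finally show ?thesis by (simp add: w_def P_def)
qed

lemma continuous_on_v: "continuous_on {0<..} v"
  using v_has_derivative by (auto intro!: continuous_at_imp_continuous_on DERIV_isCont)

end


section \<open>Asymptotic expansions\<close>

lemma powr_tail_integral:
  fixes s p :: real
  assumes "s > 0" "p > 1"
  shows "set_integrable lborel {s<..} (\<lambda>t. t powr (- p))"
    "(LBINT t:{s<..}. t powr (- p)) = s powr (1 - p) / (p - 1)"
proof -
  define F where "F t = t powr (1 - p) / (1 - p)" for t
  have D: "(F has_real_derivative t powr (- p)) (at t)" if "ereal s < ereal t" for t
    using DERIV_cdivide[OF has_real_derivative_powr[of t "1 - p"], of "1 - p"] that assms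
    by (simp add: F_def[abs_def])
  have cont: "isCont (\<lambda>t. t powr (- p)) t" if "ereal s < ereal t" for t
    using that assms by (intro continuous_intros) auto
  have lim_s: "((F \<circ> real_of_ereal) \<longlongrightarrow> F s) (at_right (ereal s))"
    unfolding ereal_tendsto_simps F_def
    by (rule tendsto_eq_intros refl)+ (use assms in auto)
  have "(F \<longlongrightarrow> 0) at_top" unfolding F_def using assms by real_asymp
  then have lim_inf: "((F \<circ> real_of_ereal) \<longlongrightarrow> 0) (at_left \<infinity>)"
    by (simp add: ereal_tendsto_simps)
  have "AE t in lborel. ereal s < ereal t \<longrightarrow> ereal t < \<infinity> \<longrightarrow> 0 \<le> t powr (- p)" by simp
  note FTC = interval_integral_FTC_nonneg[OF _ D cont this lim_s lim_inf]
  moreover have "0 - F s = s powr (1 - p) / (p - 1)"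
    unfolding F_def using assms by (simp add: field_simps)
  ultimately show "set_integrable lborel {s<..} (\<lambda>t. t powr (- p))"
    "(LBINT t:{s<..}. t powr (- p)) = s powr (1 - p) / (p - 1)"
    using FTC by (simp_all add: interval_integral_to_infinity_eq)
qed

text \<open>Here \<open>g\<close> is the part of v - 1 that need not be integrable, and
  \<open>\<gamma>\<close> its antiderivative. Since omega minus \<open>s + \<gamma> s\<close> has
  derivative \<open>v - 1 - g\<close>, its distance from its limit is a tail integral, bounded by
  that of \<open>C * t powr (- p)\<close>.\<close>

lemma omega_expansion:
  fixes v \<gamma> g :: "real \<Rightarrow> real"
  assumes v: "continuous_on {0<..} v" and sbar: "sbar > 0"
    and \<gamma>: "\<And>s. s > 0 \<Longrightarrow> (\<gamma> has_real_derivative g s) (at s)"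
    and g: "continuous_on {0<..} g"
    and p: "p > 1"
    and bound: "\<And>t. t \<ge> sbar \<Longrightarrow> \<bar>v t - 1 - g t\<bar> \<le> C * t powr (- p)"
  shows "interval_lebesgue_integrable lborel sbar \<infinity> (\<lambda>t. v t - 1 - g t)"
    and "s \<ge> sbar \<Longrightarrow>
      \<bar>omega v \<beta> sbar s - (s + \<gamma> s + (\<beta> - sbar - \<gamma> sbar + (LBINT t=sbar..\<infinity>. v t - 1 - g t)))\<bar>
        \<le> C / (p - 1) * s powr (1 - p)"
proof -
  define r where "r t = v t - 1 - g t" for t
  have r_cont: "continuous_on {0<..} r"
    unfolding r_def by (intro continuous_intros v g)
  have integrable: "set_integrable lborel {s<..} r" if "s \<ge> sbar" for s
  proof (rule set_integrable_bound)
    show "set_integrable lborel {s<..} (\<lambda>t. C * t powr (- p))"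
      using powr_tail_integral[of s p] that sbar p by (intro set_integrable_mult_right) auto
    have "continuous_on {s<..} r" by (rule continuous_on_subset[OF r_cont]) (use that sbar in auto)
    then show "set_borel_measurable lborel {s<..} r"
      unfolding set_borel_measurable_def
      using borel_measurable_continuous_on_indicator[of "{s<..}" r] by simp
    show "AE t in lborel. t \<in> {s<..} \<longrightarrow> norm (r t) \<le> norm (C * t powr (- p))"
    proof (intro AE_I2 impI)
      fix t assume "t \<in> {s<..}"
      then have "\<bar>r t\<bar> \<le> C * t powr (- p)" using bound[of t] that by (simp add: r_def)
      then show "norm (r t) \<le> norm (C * t powr (- p))" by simp
    qed
  qed
  show int: "interval_lebesgue_integrable lborel sbar \<infinity> (\<lambda>t. v t - 1 - g t)"
    using integrable[of sbar] unfolding r_def interval_integrable_to_infinity_eq by simp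
  assume s: "s \<ge> sbar"
  define \<Omega> where "\<Omega> t = omega v \<beta> sbar t - t - \<gamma> t" for t
  have \<Omega>: "(\<Omega> has_real_derivative r t) (at t)" if "t > 0" for t
    unfolding \<Omega>_def r_def
    by (auto intro!: derivative_eq_intros omega_has_derivative[OF v sbar] \<gamma> that)
  have "(LBINT t=sbar..s. r t) = \<Omega> s - \<Omega> sbar"
  proof (rule interval_integral_FTC_finite)
    show "continuous_on {min sbar s..max sbar s} r"
      by (rule continuous_on_subset[OF r_cont]) (use s sbar in auto)
    fix t assume "min sbar s \<le> t" "t \<le> max sbar s"
    then have "t > 0" using s sbar by simp
    then show "(\<Omega> has_vector_derivative r t) (at t within {min sbar s..max sbar s})"
      using \<Omega> has_real_derivative_iff_has_vector_derivative has_vector_derivative_at_within by blast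
  qed
  moreover have "(LBINT t=sbar..s. r t) + (LBINT t=s..\<infinity>. r t) = (LBINT t=sbar..\<infinity>. r t)"
  proof (rule interval_integral_sum)
    have "min (ereal sbar) (min (ereal s) \<infinity>) = sbar" "max (ereal sbar) (max (ereal s) \<infinity>) = \<infinity>"
      using s by (auto simp: min_def max_def)
    then show "interval_lebesgue_integrable lborel (min (ereal sbar) (min (ereal s) \<infinity>))
      (max (ereal sbar) (max (ereal s) \<infinity>)) r"
      using int by (simp add: r_def[abs_def])
  qed
  moreover have "\<Omega> sbar = \<beta> - sbar - \<gamma> sbar"
    by (simp add: \<Omega>_def omega_def)
  ultimately have "omega v \<beta> sbar s - (s + \<gamma> s + (\<beta> - sbar - \<gamma> sbar + (LBINT t=sbar..\<infinity>. r t)))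
      = - (LBINT t=s..\<infinity>. r t)"
    by (simp add: \<Omega>_def)
  moreover have "\<bar>LBINT t=s..\<infinity>. r t\<bar> \<le> C / (p - 1) * s powr (1 - p)"
  proof -
    have "\<bar>LBINT t:{s<..}. r t\<bar> \<le> (LBINT t:{s<..}. \<bar>r t\<bar>)"
      using set_integral_norm_bound[OF integrable[OF s]] by simp
    also have "\<dots> \<le> (LBINT t:{s<..}. C * t powr (- p))"
    proof (rule set_integral_mono)
      show "set_integrable lborel {s<..} (\<lambda>t. \<bar>r t\<bar>)"
        using integrable[OF s] by (rule set_integrable_abs)
      show "set_integrable lborel {s<..} (\<lambda>t. C * t powr (- p))"
        using powr_tail_integral[of s p] s sbar p by (intro set_integrable_mult_right) auto
      show "\<bar>r t\<bar> \<le> C * t powr (- p)" if "t \<in> {s<..}" for t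
        using bound[of t] that s by (simp add: r_def)
    qed
    also have "\<dots> = C * (s powr (1 - p) / (p - 1))"
      using powr_tail_integral[of s p] s sbar p by simp
    finally show ?thesis by (simp add: interval_integral_to_infinity_eq)
  qed
  ultimately show "\<bar>omega v \<beta> sbar s - (s + \<gamma> s + (\<beta> - sbar - \<gamma> sbar + (LBINT t=sbar..\<infinity>. v t - 1 - g t)))\<bar>
        \<le> C / (p - 1) * s powr (1 - p)"
    by (simp add: r_def)
qed

text \<open>The quadratic form is at least a multiple of the squared norm; as
  \<open>e \<le> 0\<close>, this bounds its power from above.\<close>

lemma bigo_radial:
  fixes a :: "real^'n" and F :: "real \<Rightarrow> real"
  assumes a: "\<And>i. a $ i > 0" and e: "e \<le> 0" and s0: "s0 > 0"
    and F: "\<And>s. s \<ge> s0 \<Longrightarrow> \<bar>F s\<bar> \<le> C * s powr e"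
  shows "(\<lambda>x. F (half_quad a x)) \<in> O[at_infinity](\<lambda>x. norm x powr (2 * e))"
proof -
  obtain m where m: "m > 0" "\<And>x. m * (norm x)\<^sup>2 \<le> half_quad a x"
    using half_quad_lower_bound[OF a] by blast
  have C: "C \<ge> 0"
  proof -
    have "0 \<le> C * s0 powr e" using F[of s0] by (smt (verit) abs_ge_zero)
    then show ?thesis using s0 by (simp add: zero_le_mult_iff)
  qed
  define R where "R = sqrt (s0 / m)"
  have R: "R > 0" using s0 m by (simp add: R_def)
  have "norm (F (half_quad a x)) \<le> (C * m powr e) * norm (norm x powr (2 * e))"
    if x: "norm x \<ge> R" for x
  proof -
    have pos: "norm x > 0" using x R by linarith
    have "s0 / m = R\<^sup>2" using s0 m by (simp add: R_def)
    also have "\<dots> \<le> (norm x)\<^sup>2" using x R by (intro power_mono) auto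
    finally have "s0 \<le> m * (norm x)\<^sup>2" using m by (simp add: field_simps)
    then have "\<bar>F (half_quad a x)\<bar> \<le> C * half_quad a x powr e"
      using m(2)[of x] by (intro F) linarith
    also have "half_quad a x powr e \<le> (m * (norm x)\<^sup>2) powr e"
      using m pos e by (intro powr_mono2') auto
    also have "\<dots> = m powr e * norm x powr (2 * e)"
      using m pos by (simp add: powr_mult powr_powr flip: powr_numeral)
    finally show ?thesis using C by (simp add: mult.assoc mult_left_mono)
  qed
  then show ?thesis
    by (intro bigoI[where c = "C * m powr e"]) (auto simp: eventually_at_infinity)
qed


section \<open>The subsolution property\<close>

lemma omega_expansion_bigo:
  fixes a :: "real^'n" and v \<gamma> g :: "real \<Rightarrow> real"
  assumes a: "\<And>i. a $ i > 0"
    and v: "continuous_on {0<..} v" and sbar: "sbar > 0"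
    and \<gamma>: "\<And>s. s > 0 \<Longrightarrow> (\<gamma> has_real_derivative g s) (at s)"
    and g: "continuous_on {0<..} g"
    and p: "p > 1"
    and bound: "\<And>t. t \<ge> sbar \<Longrightarrow> \<bar>v t - 1 - g t\<bar> \<le> C * t powr (- p)"
  shows "(\<lambda>x. omega v \<beta> sbar (half_quad a x) - (half_quad a x + \<gamma> (half_quad a x)
      + (\<beta> - sbar - \<gamma> sbar + (LBINT t=sbar..\<infinity>. v t - 1 - g t))))
    \<in> O[at_infinity](\<lambda>x. norm x powr (2 * (1 - p)))"
  by (rule bigo_radial[OF a _ sbar, where F = "\<lambda>s. omega v \<beta> sbar s - (s + \<gamma> s
      + (\<beta> - sbar - \<gamma> sbar + (LBINT t=sbar..\<infinity>. v t - 1 - g t)))" and C = "C / (p - 1)"])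
    (use omega_expansion(2)[OF v sbar \<gamma> g p bound] p in auto)

text \<open>By the mean value theorem. It makes the factor v^p - 1 linear in v - 1 with a constant
  uniform on bounded ranges.\<close>

lemma powr_minus_1_le:
  fixes w V p :: real
  assumes "1 \<le> w" "w \<le> V" "p \<ge> 0"
  shows "w powr p - 1 \<le> p * V powr p * (w - 1)"
proof (cases "w = 1")
  case False
  with assms have w: "1 < w" by simp
  have "\<exists>z>1. z < w \<and> w powr p - 1 powr p = (w - 1) * (p * z powr (p - 1))"
    using w by (intro MVT2) (auto intro!: has_real_derivative_powr)
  then obtain z where z: "1 < z" "z < w" "w powr p - 1 = (w - 1) * (p * z powr (p - 1))"
    by auto
  \<comment> \<open>The exponent \<open>p - 1\<close> may be negative, so it is raised to
    \<open>p\<close> before monotonicity in the base is used.\<close>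
  have "z powr (p - 1) \<le> z powr p" using z by (intro powr_mono) auto
  also have "\<dots> \<le> V powr p" using z assms by (intro powr_mono2) auto
  finally have "(w - 1) * (p * z powr (p - 1)) \<le> (w - 1) * (p * V powr p)"
    using w assms by (intro mult_left_mono) auto
  with z(3) show ?thesis by (simp add: mult_ac)
qed simp

section \<open>Hessian of the radial function and subsolution property\<close>

context radial_profile
begin

definition v' :: "real \<Rightarrow> real" where
  "v' s = - v s * (v s ^ (k - l) - 1) / (2 * s * (Hk * v s ^ (k - l) - hl))"

lemma DERIV_v: "s > 0 \<Longrightarrow> (v has_real_derivative v' s) (at s)"
  unfolding v'_def by (rule v_has_derivative)

lemma v_denom_pos: "s > 0 \<Longrightarrow> Hk * v s ^ (k - l) - hl > 0"
  using denom_pos v_gt_1 by blast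

lemma v'_neg: "s > 0 \<Longrightarrow> v' s < 0"
  using v_gt_1[of s] v_power_gt_1[of s] v_denom_pos[of s]
  by (simp add: v'_def mult_neg_pos divide_neg_pos)

text \<open>Closed form of v + 2 s Hk v', the factor left in the Hessian formula when every ratio is
  replaced by \<open>Hk\<close>.\<close>

definition residual :: "real \<Rightarrow> real" where
  "residual s = v s * (Hk - hl) / (Hk * v s ^ (k - l) - hl)"

lemma residual_pos: "s > 0 \<Longrightarrow> residual s > 0"
  using v_gt_1[of s] v_denom_pos[of s] Hk by (simp add: residual_def)

lemma residual_Hk: "s > 0 \<Longrightarrow> v s + 2 * s * Hk * v' s = residual s"
  using v_denom_pos[of s] by (simp add: residual_def v'_def divide_simps) (simp add: algebra_simps)

text \<open>Replacing \<open>Hk\<close> by \<open>hl\<close> multiplies the factor by exactly the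
  power of \<open>v\<close> by which the degrees of sigma_k and sigma_l differ.\<close>

lemma residual_hl: "s > 0 \<Longrightarrow> v s + 2 * s * hl * v' s = v s ^ (k - l) * residual s"
  using v_denom_pos[of s] by (simp add: residual_def v'_def divide_simps) (simp add: algebra_simps)

text \<open>The derivatives of \<open>v\<close>, 1/s, the reciprocal \<open>D\<close> of the
  denominator in v', and omega are polynomials in these four functions. Reciprocals are generators
  because the algebra has no division.\<close>

lemma smooth_on_omega:
  fixes a :: "real^'n"
  assumes a: "\<And>i. a $ i > 0" and sbar: "sbar > 0"
  shows "smooth_on (- {0}) (\<lambda>x. omega v \<beta> sbar (half_quad a x))"
proof -
  define D where "D s = inverse (Hk * v s ^ (k - l) - hl)" for s
  define \<Phi> where "\<Phi> = {v, inverse, D, omega v \<beta> sbar}"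
  note gen = generated_algebra.intros generated_algebra_power generated_algebra_diff
  have in_\<Phi>: "v \<in> generated_algebra \<Phi>" "inverse \<in> generated_algebra \<Phi>" "D \<in> generated_algebra \<Phi>"
    by (auto intro!: generated_algebra.generator simp: \<Phi>_def)
  define V where "V s = (- 1 / 2) * (v s * ((v s ^ (k - l) - 1) * (inverse s * D s)))" for s
  have V: "V \<in> generated_algebra \<Phi>"
    unfolding V_def[abs_def] by (intro gen(2-) in_\<Phi>)
  have v_V: "(v has_real_derivative V s) (at s)" if "s > 0" for s
  proof -
    have "V s = v' s" using v_denom_pos[OF that] that
      by (simp add: V_def v'_def D_def divide_simps)
    then show ?thesis using DERIV_v[OF that] by simp
  qed
  show ?thesis
  proof (rule smooth_on_radial[OF a, where \<Phi> = \<Phi>])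
    show "omega v \<beta> sbar \<in> \<Phi>" by (simp add: \<Phi>_def)
    fix \<phi> assume "\<phi> \<in> \<Phi>"
    then consider "\<phi> = v" | "\<phi> = inverse" | "\<phi> = D" | "\<phi> = omega v \<beta> sbar"
      by (auto simp: \<Phi>_def)
    then show "\<exists>\<psi>\<in>generated_algebra \<Phi>. \<forall>s>0. (\<phi> has_real_derivative \<psi> s) (at s)"
    proof cases
      case 1
      then show ?thesis using V v_V by blast
    next
      case 2
      have mem: "(\<lambda>s. (- 1) * (inverse s * inverse s)) \<in> generated_algebra \<Phi>"
        by (intro gen(2-) in_\<Phi>)
      have der: "(inverse has_real_derivative (- 1) * (inverse s * inverse s)) (at s)" if "s > 0" for s :: real
        using DERIV_inverse[of s] that by (simp add: power2_eq_square eval_nat_numeral)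
      show ?thesis unfolding 2 by (rule bexI[OF _ mem]) (use der in blast)
    next
      case 3
      have mem: "(\<lambda>s. (- Hk * real (k - l)) * ((v s ^ (k - l - 1) * V s) * (D s * D s))) \<in> generated_algebra \<Phi>"
        by (intro gen(2-) in_\<Phi> V)
      have der: "(D has_real_derivative (- Hk * real (k - l)) * ((v s ^ (k - l - 1) * V s) * (D s * D s))) (at s)"
        if "s > 0" for s
      proof -
        have "Hk * v s ^ (k - l) - hl \<noteq> 0" using v_denom_pos[OF that] by simp
        then show ?thesis
          unfolding D_def[abs_def]
          by (auto intro!: derivative_eq_intros v_V that)
      qed
      show ?thesis unfolding 3 by (rule bexI[OF _ mem]) (use der in blast)
    next
      case 4
      then show ?thesis using in_\<Phi>(1) omega_has_derivative[OF continuous_on_v sbar] by blast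
    qed
  qed
qed

text \<open>The rank-one formula at the diagonal \<open>v\<close> times \<open>a\<close>, where
  homogeneity pulls out the powers of \<open>v\<close> and one factor a_i of the squared entries of
  A x is absorbed in the ratio.\<close>

lemma elem_sym_hessian:
  fixes a x :: "real^'n"
  assumes a: "\<And>i. a $ i > 0" and sbar: "sbar > 0" and x: "x \<noteq> 0" and j: "1 \<le> j" "j \<le> CARD('n)"
  shows "elem_sym j (eigvals (hessian (\<lambda>x. omega v \<beta> sbar (half_quad a x)) x))
    = v (half_quad a x) ^ (j - 1) * elem_sym j a * (v (half_quad a x)
        + v' (half_quad a x) * (\<Sum>i\<in>UNIV. esym_ratio j i a * (a $ i * (x $ i)\<^sup>2)))"
proof -
  define s where "s = half_quad a x"
  have s: "s > 0" using half_quad_pos[OF a x] by (simp add: s_def)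
  have Ej: "elem_sym j a > 0" using elem_sym_pos[of a j] a j by simp
  have hess: "hessian (\<lambda>x. omega v \<beta> sbar (half_quad a x)) x
    = (\<chi> i m. (if i = m then (v s *\<^sub>R a) $ i else 0)
        + v' s * (\<chi> i. a $ i * x $ i) $ i * (\<chi> i. a $ i * x $ i) $ m)"
    unfolding s_def
    by (intro hessian_radial a x omega_has_derivative continuous_on_v sbar DERIV_v half_quad_pos)
  have "elem_sym j (eigvals (hessian (\<lambda>x. omega v \<beta> sbar (half_quad a x)) x))
    = elem_sym j (v s *\<^sub>R a) + v' s * (\<Sum>i\<in>UNIV. ((\<chi> i. a $ i * x $ i) $ i)\<^sup>2 * elem_sym_del (j - 1) i (v s *\<^sub>R a))"
    unfolding hess by (rule elem_sym_eigvals_diag_plus_rank_one[OF j(1)])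
  also have "(\<Sum>i\<in>UNIV. ((\<chi> i. a $ i * x $ i) $ i)\<^sup>2 * elem_sym_del (j - 1) i (v s *\<^sub>R a))
    = v s ^ (j - 1) * elem_sym j a * (\<Sum>i\<in>UNIV. esym_ratio j i a * (a $ i * (x $ i)\<^sup>2))"
    unfolding sum_distrib_left using Ej
    by (intro sum.cong refl) (simp add: elem_sym_del_scaleR esym_ratio_def power2_eq_square)
  also have "elem_sym j (v s *\<^sub>R a) = v s ^ (j - 1) * elem_sym j a * v s"
    using j by (cases j) (auto simp: elem_sym_scaleR)
  finally show ?thesis unfolding s_def by (simp add: algebra_simps)
qed

lemma subsolution:
  fixes a :: "real^'n"
  assumes a: "\<And>i. a $ i > 0" and sbar: "sbar > 0" and k: "k \<le> CARD('n)"
    and Hk_eq: "Hk = H_max k a" and hl_eq: "hl = h_min l a" and adm: "elem_sym k a = elem_sym l a"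
  shows "smooth_subsolution_on k l (- {0}) (\<lambda>x. omega v \<beta> sbar (half_quad a x))"
proof -
  define \<omega> where "\<omega> x = omega v \<beta> sbar (half_quad a x)" for x
  define E where "E x j = elem_sym j (eigvals (hessian \<omega> x))" for x j
  have smooth: "smooth_on (- {0}) \<omega>"
    unfolding \<omega>_def by (rule smooth_on_omega[OF a sbar])
  have lower: "E x j \<ge> v (half_quad a x) ^ (j - 1) * elem_sym j a * residual (half_quad a x)"
    if x: "x \<noteq> 0" and j: "1 \<le> j" "j \<le> k" for x j
  proof -
    define s where "s = half_quad a x"
    have s: "s > 0" using half_quad_pos[OF a x] by (simp add: s_def)
    \<comment> \<open>Ratios of order \<open>j\<close> are at most those of order \<open>k\<close>,
      hence at most \<open>Hk\<close>, and the remaining weights sum to 2s. Multiplying by the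
      negative v' turns this into a lower bound.\<close>
    have "(\<Sum>i\<in>UNIV. esym_ratio j i a * (a $ i * (x $ i)\<^sup>2)) \<le> (\<Sum>i\<in>UNIV. Hk * (a $ i * (x $ i)\<^sup>2))"
    proof (intro sum_mono mult_right_mono)
      fix i
      have "esym_ratio j i a \<le> esym_ratio k i a" using a j k by (intro esym_ratio_mono) auto
      also have "\<dots> \<le> Hk" unfolding Hk_eq by (rule esym_ratio_le_H_max)
      finally show "esym_ratio j i a \<le> Hk" .
      show "0 \<le> a $ i * (x $ i)\<^sup>2" using a[of i] by simp
    qed
    also have "\<dots> = 2 * s * Hk" by (simp add: s_def half_quad_eq sum_distrib_left[symmetric])
    finally have "v' s * (2 * s * Hk) \<le> v' s * (\<Sum>i\<in>UNIV. esym_ratio j i a * (a $ i * (x $ i)\<^sup>2))"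
      using v'_neg[OF s] by (intro mult_left_mono_neg) auto
    then have "residual s \<le> v s + v' s * (\<Sum>i\<in>UNIV. esym_ratio j i a * (a $ i * (x $ i)\<^sup>2))"
      using residual_Hk[OF s] by (simp add: algebra_simps)
    moreover have "0 \<le> v s ^ (j - 1) * elem_sym j a"
      using v_gt_1[OF s] elem_sym_pos[of a j] a j k by simp
    ultimately have "v s ^ (j - 1) * elem_sym j a * residual s
      \<le> v s ^ (j - 1) * elem_sym j a * (v s + v' s * (\<Sum>i\<in>UNIV. esym_ratio j i a * (a $ i * (x $ i)\<^sup>2)))"
      by (rule mult_left_mono)
    then show ?thesis
      using elem_sym_hessian[OF a sbar x j(1)] j k by (simp add: E_def \<omega>_def[abs_def] s_def)
  qed
  have pos: "E x j > 0" if x: "x \<noteq> 0" and j: "j \<le> k" for x j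
  proof (cases "j = 0")
    case False
    have s: "half_quad a x > 0" using half_quad_pos[OF a x] .
    have "0 < v (half_quad a x) ^ (j - 1) * elem_sym j a * residual (half_quad a x)"
      using v_gt_1[OF s] residual_pos[OF s] elem_sym_pos[of a j] a j k by simp
    then show ?thesis using lower[OF x, of j] False j by simp
  qed (simp add: E_def)
  have "eigvals (hessian \<omega> x) \<in> closure (Gamma_cone k)" if "x \<noteq> 0" for x
    using pos[OF that] closure_subset[of "Gamma_cone k"] by (auto simp: Gamma_cone_def E_def)
  then have convex: "k_convex_on k (- {0}) \<omega>"
    using smooth unfolding k_convex_on_def smooth_on_def by blast
  have "E x k / E x l \<ge> 1" if x: "x \<noteq> 0" for x
  proof -
    define s where "s = half_quad a x"
    have s: "s > 0" using half_quad_pos[OF a x] by (simp add: s_def)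
    have "E x l \<le> v s ^ (k - 1) * elem_sym k a * residual s"
    proof (cases "l = 0")
      \<comment> \<open>The Hessian formula starts at order 1. Here sigma_0 is 1, admissibility
        gives sigma_k(a) = 1, and the bound holds with equality.\<close>
      case True
      have "hl = 0" using True hl_eq by (simp add: h_min_eq)
      then have v_k: "v s = v s ^ k * residual s" using residual_hl[OF s] True by simp
      have "v s ^ k = v s * v s ^ (k - 1)" using lk by (cases k) auto
      then have "v s * (v s ^ (k - 1) * residual s) = v s" using v_k by (metis mult.assoc)
      then have "v s ^ (k - 1) * residual s = 1" using v_gt_1[OF s] by simp
      then show ?thesis using adm True by (simp add: E_def)
    next
      case False
      have "2 * s * hl = (\<Sum>i\<in>UNIV. hl * (a $ i * (x $ i)\<^sup>2))"
        by (simp add: s_def half_quad_eq sum_distrib_left[symmetric])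
      also have "\<dots> \<le> (\<Sum>i\<in>UNIV. esym_ratio l i a * (a $ i * (x $ i)\<^sup>2))"
        using False a by (intro sum_mono mult_right_mono) (auto simp: hl_eq h_min_le_esym_ratio less_imp_le)
      finally have "v' s * (\<Sum>i\<in>UNIV. esym_ratio l i a * (a $ i * (x $ i)\<^sup>2)) \<le> v' s * (2 * s * hl)"
        using v'_neg[OF s] by (intro mult_left_mono_neg) auto
      then have "v s + v' s * (\<Sum>i\<in>UNIV. esym_ratio l i a * (a $ i * (x $ i)\<^sup>2)) \<le> v s ^ (k - l) * residual s"
        using residual_hl[OF s] by (simp add: algebra_simps)
      moreover have "0 \<le> v s ^ (l - 1) * elem_sym l a"
        using v_gt_1[OF s] elem_sym_pos[of a l] a lk k by simp
      ultimately have "v s ^ (l - 1) * elem_sym l a * (v s + v' s * (\<Sum>i\<in>UNIV. esym_ratio l i a * (a $ i * (x $ i)\<^sup>2)))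
        \<le> v s ^ (l - 1) * elem_sym l a * (v s ^ (k - l) * residual s)"
        by (rule mult_left_mono)
      \<comment> \<open>Admissibility replaces sigma_l(a) by sigma_k(a), and the power of
        \<open>v\<close> becomes that of the lower bound for sigma_k.\<close>
      also have "\<dots> = v s ^ (l - 1 + (k - l)) * elem_sym k a * residual s"
        by (simp add: power_add adm)
      also have "l - 1 + (k - l) = k - 1" using False lk by simp
      finally show ?thesis
        using elem_sym_hessian[OF a sbar x, of l] False lk k by (simp add: E_def \<omega>_def[abs_def] s_def)
    qed
    also have "\<dots> \<le> E x k" using lower[OF x, of k] lk by (simp add: s_def)
    finally show ?thesis using pos[OF x, of l] lk by simp
  qed
  with smooth convex show ?thesis
    unfolding smooth_subsolution_on_def \<omega>_def[symmetric] E_def by simp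
qed

section \<open>Decay of the profile at infinity\<close>

text \<open>In the equation of \<open>v\<close>, the power v^(k-l) is at least \<open>v\<close> and
  the other factor is at least 1.\<close>

lemma v_minus_1_le:
  assumes "s > 0"
  shows "v s - 1 \<le> \<alpha> * s powr (- H)"
proof -
  have "v s \<le> v s ^ (k - l)" using v_gt_1[OF assms] lk by (intro self_le_power) auto
  moreover have "(v s ^ (k - l) - 1) * 1 \<le> (v s ^ (k - l) - 1) * v s powr (2 * H * hl)"
    using v_gt_1[OF assms] v_power_gt_1[OF assms] H_hl_nonneg
    by (intro mult_left_mono ge_one_powr_ge_zero) (auto simp: mult.assoc)
  ultimately show ?thesis using v_eq[OF assms] by simp
qed

text \<open>The term \<open>- 0\<close> matches the hypothesis of \<open>omega_expansion\<close> for
  \<open>g\<close> = 0.\<close>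

lemma v_minus_1_abs_le: "s > 0 \<Longrightarrow> \<bar>v s - 1 - 0\<bar> \<le> \<alpha> * s powr (- H)"
  using v_minus_1_le[of s] v_gt_1[of s] by simp

lemma decay_square: "s > 0 \<Longrightarrow> (\<alpha> * s powr (- H))\<^sup>2 = \<alpha>\<^sup>2 * s powr (- (2 * H))"
  by (simp add: power_mult_distrib power2_eq_square flip: powr_add)

text \<open>With p = 2 H hl the equation reads y = (v - 1) v^p, where y is the leading term. The
  error is (v - 1)(v^p - 1), which is quadratic in v - 1.\<close>

lemma v_second_order:
  assumes "k - l = 1" and sbar: "sbar > 0"
  obtains C where "\<And>s. s \<ge> sbar \<Longrightarrow> \<bar>v s - 1 - \<alpha> * s powr (- H)\<bar> \<le> C * s powr (- (2 * H))"
proof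
  define p where "p = 2 * H * hl"
  \<comment> \<open>An upper bound for \<open>v\<close> on the whole half-line from
    \<open>sbar\<close>, making the constant independent of \<open>s\<close>.\<close>
  define V where "V = 1 + \<alpha> * sbar powr (- H)"
  have p: "p \<ge> 0" using H_hl_nonneg by (simp add: p_def mult.assoc)
  fix s assume "s \<ge> sbar"
  then have s: "s > 0" using sbar by simp
  define y where "y = \<alpha> * s powr (- H)"
  have w: "v s > 1" "v s - 1 \<le> y" using v_gt_1[OF s] v_minus_1_le[OF s] by (auto simp: y_def)
  have "s powr (- H) \<le> sbar powr (- H)"
    using \<open>s \<ge> sbar\<close> sbar H_pos by (intro powr_mono2') auto
  then have V: "v s \<le> V" using w \<alpha> unfolding V_def y_def
    by (smt (verit) mult_left_mono)
  have y: "y = (v s - 1) * v s powr p" using v_eq[OF s] assms(1) by (simp add: y_def p_def)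
  have "y - (v s - 1) = (v s - 1) * (v s powr p - 1)" by (simp add: y algebra_simps)
  also have "\<dots> \<le> (v s - 1) * (p * V powr p * (v s - 1))"
    using w p V by (intro mult_left_mono powr_minus_1_le) auto
  also have "\<dots> = p * V powr p * (v s - 1)\<^sup>2" by (simp add: power2_eq_square)
  also have "\<dots> \<le> p * V powr p * y\<^sup>2" using w p by (intro mult_left_mono power_mono) auto
  also have "\<dots> = p * V powr p * \<alpha>\<^sup>2 * s powr (- (2 * H))"
    unfolding y_def decay_square[OF s] by simp
  finally show "\<bar>v s - 1 - \<alpha> * s powr (- H)\<bar> \<le> (p * V powr p * \<alpha>\<^sup>2) * s powr (- (2 * H))"
    using w by (simp add: y_def)
qed

text \<open>The equation is v^2 - 1 = y, so y/2 exceeds v - 1 by exactly (v - 1)^2 / 2.\<close>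

lemma v_second_order_square:
  assumes "k - l = 2" "hl = 0" "s > 0"
  shows "\<bar>v s - 1 - \<alpha> / 2 * s powr (- H)\<bar> \<le> \<alpha>\<^sup>2 / 2 * s powr (- (2 * H))"
proof -
  define y where "y = \<alpha> * s powr (- H)"
  have w: "v s > 1" "v s - 1 \<le> y"
    using v_gt_1[OF assms(3)] v_minus_1_le[OF assms(3)] by (auto simp: y_def)
  have "y = (v s)\<^sup>2 - 1" using v_eq[OF assms(3)] assms w by (simp add: y_def)
  then have "y / 2 - (v s - 1) = (v s - 1)\<^sup>2 / 2" by (simp add: power2_eq_square field_simps)
  moreover have "(v s - 1)\<^sup>2 \<le> y\<^sup>2" using w by (intro power_mono) auto
  moreover have "y\<^sup>2 = \<alpha>\<^sup>2 * s powr (- (2 * H))" unfolding y_def by (rule decay_square[OF assms(3)])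
  ultimately show ?thesis
    by (simp add: y_def abs_if split: if_splits) (use zero_le_power2[of "v s - 1"] in linarith)
qed

end

section \<open>Admissible diagonal matrices and the four expansions\<close>

lemma pos_def_diag:
  assumes "pos_def (diag a)"
  shows "a $ i > 0"
proof -
  have "axis i 1 \<bullet> (diag a *v axis i 1) > 0"
    using assms by (simp add: pos_def_def axis_eq_0_iff)
  then have "half_quad a (axis i 1) > 0" by (simp add: half_quad_def)
  also have "half_quad a (axis i 1) = a $ i / 2"
  proof -
    have "(axis i 1 $ j)\<^sup>2 = axis i (1 :: real) $ j" for j by (simp add: axis_def)
    then show ?thesis by (simp add: half_quad_eq sum_axis)
  qed
  finally show ?thesis by simp
qed

theorem proposition2p1:
  fixes a :: "real^'n" and k l :: nat and \<alpha> \<beta> sbar :: real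
  defines "A \<equiv> diag a"
  defines "Hk \<equiv> H_max k (eigvals A)"
  defines "hl \<equiv> h_min l (eigvals A)"
  defines "\<H> \<equiv> real (k - l) / (2 * (Hk - hl))"
  defines "v \<equiv> v_sol k l \<H> hl \<alpha>"
  defines "q \<equiv> (\<lambda>x :: real^'n. 1 / 2 * (x \<bullet> (A *v x)))"
  defines "\<omega> \<equiv> (\<lambda>x. omega v \<beta> sbar (q x))"
  assumes "CARD('n) \<ge> 2" and "l < k" and "k \<le> CARD('n)" and "\<alpha> > 0"
    and "A \<in> admissible k l" and "sbar > 0"
  shows "smooth_subsolution_on k l (- {0}) \<omega> \<and>
    (CARD('n) \<ge> 3 \<longrightarrow>
       (k - l = 1 \<and> Hk - hl < 1 / 2 \<longrightarrow>
          interval_lebesgue_integrable lborel sbar \<infinity> (\<lambda>t. v t - 1) \<and>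
          (\<lambda>x. \<omega> x - (q x + mu1 v \<beta> sbar))
            \<in> O[at_infinity](\<lambda>x. norm x powr (2 - 2 * \<H>))) \<and>
       (k - l \<ge> 2 \<longrightarrow>
          interval_lebesgue_integrable lborel sbar \<infinity> (\<lambda>t. v t - 1) \<and>
          (\<exists>\<theta>::real.
             (if l = 0 \<and> k = CARD('n) then \<theta> = 1
              else \<theta> \<in> {(real (k - l) - 2) / (real CARD('n) - 2) <.. 1}) \<and>
             (\<lambda>x. \<omega> x - (q x + mu1 v \<beta> sbar))
               \<in> O[at_infinity](\<lambda>x. norm x powr (\<theta> * (2 - real CARD('n))))))) \<and>
    (CARD('n) = 2 \<and> k = 2 \<and> l = 0 \<longrightarrow>
       interval_lebesgue_integrable lborel sbar \<infinity> (\<lambda>t. v t - 1 - \<alpha> / (2 * t)) \<and>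
       (\<lambda>x. \<omega> x - (q x + \<alpha> / 2 * ln (q x) + mu2 v \<alpha> \<beta> sbar))
         \<in> O[at_infinity](\<lambda>x. norm x powr (- 2))) \<and>
    (k - l = 1 \<and> Hk - hl = 1 / 2 \<longrightarrow>
       interval_lebesgue_integrable lborel sbar \<infinity> (\<lambda>t. v t - 1 - \<alpha> / t) \<and>
       (\<lambda>x. \<omega> x - (q x + \<alpha> * ln (q x) + mu3 v \<alpha> \<beta> sbar))
         \<in> O[at_infinity](\<lambda>x. norm x powr (- 2))) \<and>
    (k - l = 1 \<and> Hk - hl > 1 / 2 \<longrightarrow>
       interval_lebesgue_integrable lborel sbar \<infinity>
         (\<lambda>t. v t - 1 - \<alpha> * t powr (- (1 / (2 * (Hk - hl))))) \<and>
       (\<exists>\<theta>::real. \<theta> \<in> {-1 <..< 0} \<and>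
          (\<lambda>x. \<omega> x - (q x
               + \<alpha> / (1 - 1 / (2 * (Hk - hl))) * q x powr (1 - 1 / (2 * (Hk - hl)))
               + mu4 v Hk hl \<alpha> \<beta> sbar))
            \<in> O[at_infinity](\<lambda>x. norm x powr (2 * \<theta>))))"
proof -
  define n where "n = CARD('n)"
  have a: "a $ i > 0" for i
    using \<open>A \<in> admissible k l\<close> pos_def_diag[of a i] by (simp add: A_def admissible_def)
  have Hk_a: "Hk = H_max k a" and hl_a: "hl = h_min l a"
    unfolding Hk_def hl_def A_def by (simp_all add: H_max_eigvals_diag[OF a])
  have adm: "elem_sym k a = elem_sym l a"
    using \<open>A \<in> admissible k l\<close> by (simp add: A_def admissible_def elem_sym_eigvals_diag)
  have n: "n \<ge> 2" "l < n" "k \<le> n" using assms by (auto simp: n_def)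
  have hl0: "hl \<ge> 0" "hl = 0 \<longleftrightarrow> l = 0" using h_min_nonneg[of a l] a n by (auto simp: hl_a n_def)
  have Hk1: "Hk \<le> 1" "Hk = 1 \<longleftrightarrow> k = n"
    using H_max_le_1[of a k] a n \<open>l < k\<close> by (auto simp: Hk_a n_def)
  \<comment> \<open>The two averaging bounds give both \<open>hl < Hk\<close> and, later,
    \<open>2 * \<H> \<le> n\<close>.\<close>
  have gap: "real (k - l) / n \<le> Hk - hl"
    using H_max_ge[of a k] h_min_le[of a l] a n \<open>l < k\<close>
    by (auto simp: Hk_a hl_a n_def of_nat_diff diff_divide_distrib)
  have "real (k - l) / n > 0" using \<open>l < k\<close> n by simp
  with gap have "hl < Hk" by linarith
  have profile: "radial_profile k l Hk hl \<alpha>"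
    by unfold_locales (use \<open>l < k\<close> \<open>hl < Hk\<close> hl0 \<open>\<alpha> > 0\<close> in auto)
  have \<H>: "\<H> = radial_profile.H k l Hk hl"
    unfolding \<H>_def radial_profile.H_def[OF profile] ..
  have v: "v = radial_profile.v k l Hk hl \<alpha>"
    unfolding v_def radial_profile.v_def[OF profile] \<H> ..
  interpret radial_profile k l Hk hl \<alpha> by (rule profile)
  have q: "q = half_quad a" by (simp add: q_def A_def half_quad_def fun_eq_iff)
  note exp = omega_expansion[OF continuous_on_v \<open>sbar > 0\<close>, folded v]
    omega_expansion_bigo[OF a continuous_on_v \<open>sbar > 0\<close>, folded v q]
  \<comment> \<open>The gap is 1 only if \<open>Hk\<close> = 1 and \<open>hl\<close> = 0. This
    extreme case forces \<theta> = 1 in (i) and has to be excluded in (iv).\<close>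
  have le1: "Hk - hl \<le> 1" "Hk - hl = 1 \<longleftrightarrow> k = n \<and> l = 0"
  proof -
    show "Hk - hl \<le> 1" using Hk1 hl0 by linarith
    have "Hk - hl = 1 \<longleftrightarrow> Hk = 1 \<and> hl = 0" using Hk1(1) hl0(1) by auto
    then show "Hk - hl = 1 \<longleftrightarrow> k = n \<and> l = 0" using Hk1 hl0 by simp
  qed
  have sub: "smooth_subsolution_on k l (- {0}) \<omega>"
    unfolding \<omega>_def v q using subsolution[OF a \<open>sbar > 0\<close> _ Hk_a hl_a adm] n by (simp add: n_def)
  \<comment> \<open>Taking \<open>g\<close> = 0 and decay exponent \<open>H\<close> serves both
    halves of (i).\<close>
  have simple: "interval_lebesgue_integrable lborel sbar \<infinity> (\<lambda>t. v t - 1) \<and>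
      (\<lambda>x. \<omega> x - (q x + mu1 v \<beta> sbar)) \<in> O[at_infinity](\<lambda>x. norm x powr (2 - 2 * \<H>))"
    if "\<H> > 1"
    using exp(1)[of "\<lambda>_. 0" "\<lambda>_. 0" H \<alpha>] exp(3)[of "\<lambda>_. 0" "\<lambda>_. 0" H \<alpha> \<beta>] v_minus_1_abs_le that \<open>sbar > 0\<close>
    by (simp add: \<omega>_def mu1_def \<H> v algebra_simps)
  have i1: "\<H> > 1" if "k - l = 1" "Hk - hl < 1 / 2"
    using that \<open>hl < Hk\<close> by (simp add: \<H>_def field_simps)
  have i2: "interval_lebesgue_integrable lborel sbar \<infinity> (\<lambda>t. v t - 1) \<and>
          (\<exists>\<theta>::real.
             (if l = 0 \<and> k = CARD('n) then \<theta> = 1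
              else \<theta> \<in> {(real (k - l) - 2) / (real CARD('n) - 2) <.. 1}) \<and>
             (\<lambda>x. \<omega> x - (q x + mu1 v \<beta> sbar))
               \<in> O[at_infinity](\<lambda>x. norm x powr (\<theta> * (2 - real CARD('n)))))"
    if n3: "CARD('n) \<ge> 3" and d: "k - l \<ge> 2"
  proof -
    \<comment> \<open>Chosen so that \<open>\<theta> * (2 - n)\<close> is the exponent
      \<open>2 - 2 * \<H>\<close>; the bounds on \<theta> then translate into bounds on
      \<open>\<H>\<close>.\<close>
    define \<theta> where "\<theta> = (2 * \<H> - 2) / (real n - 2)"
    have n3: "real n > 2" using n3 by (simp add: n_def)
    have \<H>_le: "2 * \<H> \<le> n"
      using gap n \<open>hl < Hk\<close> by (simp add: \<H>_def field_simps)
    have \<H>_eq: "2 * \<H> * (Hk - hl) = real (k - l)" using \<open>hl < Hk\<close> by (auto simp: \<H>_def divide_simps)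
    have \<H>_gt: "real (k - l) < 2 * \<H>" if "\<not> (l = 0 \<and> k = n)"
    proof -
      have "Hk - hl < 1" using le1 that by linarith
      then have "2 * \<H> * (Hk - hl) < 2 * \<H> * 1" using H_pos \<H> by (intro mult_strict_left_mono) auto
      then show ?thesis using \<H>_eq by simp
    qed
    have \<H>_n: "2 * \<H> = n" if "l = 0 \<and> k = n" using \<H>_eq le1 that by auto
    have "\<H> > 1"
    proof (cases "l = 0 \<and> k = n")
      case True
      then show ?thesis using \<H>_n n3 by linarith
    next
      case False
      then show ?thesis using \<H>_gt d by linarith
    qed
    moreover have "\<theta> * (2 - real n) = 2 - 2 * \<H>" using n3 by (simp add: \<theta>_def field_simps)
    moreover have "\<theta> = 1" if "l = 0 \<and> k = n" using \<H>_n[OF that] n3 by (simp add: \<theta>_def)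
    moreover have "(real (k - l) - 2) / (real n - 2) < \<theta>" if "\<not> (l = 0 \<and> k = n)"
      using \<H>_gt[OF that] n3 unfolding \<theta>_def by (intro divide_strict_right_mono) auto
    moreover have "\<theta> \<le> 1" using \<H>_le n3 by (simp add: \<theta>_def)
    ultimately show ?thesis using simple unfolding n_def by (intro conjI exI[of _ \<theta>]) auto
  qed
  have ii: "interval_lebesgue_integrable lborel sbar \<infinity> (\<lambda>t. v t - 1 - \<alpha> / (2 * t)) \<and>
       (\<lambda>x. \<omega> x - (q x + \<alpha> / 2 * ln (q x) + mu2 v \<alpha> \<beta> sbar))
         \<in> O[at_infinity](\<lambda>x. norm x powr (- 2))"
    if "CARD('n) = 2 \<and> k = 2 \<and> l = 0"
  proof -
    have "hl = 0" "Hk = 1" using that hl0 Hk1 by (auto simp: n_def)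
    have "k - l = 2" using that by simp
    \<comment> \<open>At this value the leading term is a multiple of 1/t, with logarithmic
      antiderivative, and the error exponent 2H equals 2.\<close>
    with \<open>hl = 0\<close> \<open>Hk = 1\<close> have H1: "H = 1" unfolding H_def by simp
    have "\<bar>v t - 1 - \<alpha> / (2 * t)\<bar> \<le> \<alpha>\<^sup>2 / 2 * t powr (- 2)" if "t \<ge> sbar" for t
    proof -
      have "t > 0" using that \<open>sbar > 0\<close> by simp
      moreover from this have "\<alpha> / (2 * t) = \<alpha> / 2 * t powr (- 1)" by (simp add: powr_minus_divide)
      moreover have "- (2 * 1) = (- 2 :: real)" by simp
      ultimately show ?thesis
        using v_second_order_square[OF \<open>k - l = 2\<close> \<open>hl = 0\<close>, of t] unfolding v H1 by metis
    qed
    moreover have "((\<lambda>t. \<alpha> / 2 * ln t) has_real_derivative \<alpha> / (2 * t)) (at t)" if "t > 0" for t :: real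
      using that by (auto intro!: derivative_eq_intros)
    moreover have "continuous_on {0<..} (\<lambda>t::real. \<alpha> / (2 * t))" by (intro continuous_intros) auto
    ultimately show ?thesis
      using exp(1)[of "\<lambda>t. \<alpha> / 2 * ln t" "\<lambda>t. \<alpha> / (2 * t)" 2 "\<alpha>\<^sup>2 / 2"]
        exp(3)[of "\<lambda>t. \<alpha> / 2 * ln t" "\<lambda>t. \<alpha> / (2 * t)" 2 "\<alpha>\<^sup>2 / 2" \<beta>]
      unfolding \<omega>_def mu2_def by simp
  qed
  have iii: "interval_lebesgue_integrable lborel sbar \<infinity> (\<lambda>t. v t - 1 - \<alpha> / t) \<and>
       (\<lambda>x. \<omega> x - (q x + \<alpha> * ln (q x) + mu3 v \<alpha> \<beta> sbar))
         \<in> O[at_infinity](\<lambda>x. norm x powr (- 2))"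
    if kl: "k - l = 1 \<and> Hk - hl = 1 / 2"
  proof -
    have H1: "H = 1" using kl unfolding H_def by (auto simp: divide_simps)
    obtain C where C: "\<And>t. t \<ge> sbar \<Longrightarrow> \<bar>v t - 1 - \<alpha> * t powr (- H)\<bar> \<le> C * t powr (- (2 * H))"
      using v_second_order[OF _ \<open>sbar > 0\<close>] kl unfolding v by blast
    have "\<bar>v t - 1 - \<alpha> / t\<bar> \<le> C * t powr (- 2)" if "t \<ge> sbar" for t
    proof -
      have "t > 0" using that \<open>sbar > 0\<close> by simp
      then have "\<alpha> / t = \<alpha> * t powr (- 1)" by (simp add: powr_minus_divide)
      moreover have "- (2 * 1) = (- 2 :: real)" by simp
      ultimately show ?thesis using C[OF that] unfolding H1 by metis
    qed
    moreover have "((\<lambda>t. \<alpha> * ln t) has_real_derivative \<alpha> / t) (at t)" if "t > 0" for t :: real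
      using that by (auto intro!: derivative_eq_intros)
    moreover have "continuous_on {0<..} (\<lambda>t::real. \<alpha> / t)" by (intro continuous_intros) auto
    ultimately show ?thesis
      using exp(1)[of "\<lambda>t. \<alpha> * ln t" "\<lambda>t. \<alpha> / t" 2 C] exp(3)[of "\<lambda>t. \<alpha> * ln t" "\<lambda>t. \<alpha> / t" 2 C \<beta>]
      unfolding \<omega>_def mu3_def by simp
  qed
  have iv: "interval_lebesgue_integrable lborel sbar \<infinity>
         (\<lambda>t. v t - 1 - \<alpha> * t powr (- (1 / (2 * (Hk - hl))))) \<and>
       (\<exists>\<theta>::real. \<theta> \<in> {-1 <..< 0} \<and>
          (\<lambda>x. \<omega> x - (q x
               + \<alpha> / (1 - 1 / (2 * (Hk - hl))) * q x powr (1 - 1 / (2 * (Hk - hl)))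
               + mu4 v Hk hl \<alpha> \<beta> sbar))
            \<in> O[at_infinity](\<lambda>x. norm x powr (2 * \<theta>)))"
    if kl: "k - l = 1 \<and> Hk - hl > 1 / 2"
  proof -
    have H: "1 / (2 * (Hk - hl)) = H" using kl unfolding H_def by simp
    \<comment> \<open>A gap of 1 would mean k = n and l = 0, so k - l = 1 would give n = 1. Hence
      \<open>H\<close> > 1/2, which makes the second-order remainder integrable.\<close>
    have "Hk - hl \<noteq> 1" using le1(2) kl n by auto
    then have "Hk - hl < 1" using le1(1) by linarith
    then have H_bounds: "1 / 2 < H" "H < 1" using kl by (auto simp: H[symmetric] divide_simps)
    define \<gamma> where "\<gamma> t = \<alpha> / (1 - H) * t powr (1 - H)" for t
    obtain C where C: "\<And>t. t \<ge> sbar \<Longrightarrow> \<bar>v t - 1 - \<alpha> * t powr (- H)\<bar> \<le> C * t powr (- (2 * H))"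
      using v_second_order[OF _ \<open>sbar > 0\<close>] kl unfolding v by blast
    have \<gamma>: "(\<gamma> has_real_derivative \<alpha> * t powr (- H)) (at t)" if "t > 0" for t
      using DERIV_cmult[OF has_real_derivative_powr[OF that, of "1 - H"], of "\<alpha> / (1 - H)"] H_bounds
      by (simp add: \<gamma>_def[abs_def])
    have cont: "continuous_on {0<..} (\<lambda>t::real. \<alpha> * t powr (- H))" by (intro continuous_intros) auto
    have "2 * H > 1" using H_bounds by simp
    note E = exp(1)[OF \<gamma> cont this C] exp(3)[OF \<gamma> cont this C, of \<beta>]
    show ?thesis
      unfolding H mu4_def \<omega>_def
      \<comment> \<open>The remainder decays with p = 2H, so its integral has exponent 1 - 2H in s,
        which lies in (-1, 0) as 1/2 < H < 1.\<close>
      using E H_bounds by (intro conjI exI[of _ "1 - 2 * H"]) (simp_all add: \<gamma>_def)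
  qed
  show ?thesis using sub simple i1 i2 ii iii iv by blast
qed

end
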